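(* Given any finite constant specification $\mathsf{CS}$ for $\mathsf{LP}$, and any sequent $\Gamma\Rightarrow\Delta$ in the language of $\mathsf{G3LP}$, it is decidable whether the sequent is derivable in $\mathsf{G3LP}_{\mathsf{CS}}$.
   Context: Logic $\mathsf{LP}$. Terms are built from justification variables and constants by binary $\cdot,+$ and unary $!$. Formulas are built from propositional variables and $\bot$ by $\neg,\wedge,\vee,\to$ and $t:A$ ($t$ a term). Axiom schemes: propositional tautologies; $s:A\to(s+t):A$, $s:A\to(t+s):A$; $s:(A\to B)\to(t:A\to(s\cdot t):B)$; $t:A\to A$; $t:A\to\,!t:t:A$. A constant specification $\mathsf{CS}$ for $\mathsf{LP}$ is a set of formulas $c:A$ with $c$ a constant and $A$ an axiom instance. Calculus $\mathsf{G3LP}_{\mathsf{CS}}$. Fix a countably infinite set of labels $w,v,u,\dots$. The labeled language has labeled formulas $w\Vvdash A$, relational atoms $wRv$ and evidence atoms $wE(t,A)$ ($A$ a formula, $t$ a term). Sequents $\Gamma\Rightarrow\Delta$ consist of finite multisets of these. Initial sequents: $w\Vvdash P,\Gamma\Rightarrow\Delta,w\Vvdash P$ ($P$ a propositional variable); $w\Vvdash\bot,\Gamma\Rightarrow\Delta$; $wRv,\Gamma\Rightarrow\Delta,wRv$; $wE(t,A),\Gamma\Rightarrow\Delta,wE(t,A)$. Rules (premises / conclusion): (L$\neg$) $\Gamma\Rightarrow\Delta,w\Vvdash A$ / $w\Vvdash\neg A,\Gamma\Rightarrow\Delta$; (R$\neg$) $w\Vvdash A,\Gamma\Rightarrow\Delta$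 / $\Gamma\Rightarrow\Delta,w\Vvdash\neg A$; (L$\wedge$) $w\Vvdash A,w\Vvdash B,\Gamma\Rightarrow\Delta$ / $w\Vvdash A\wedge B,\Gamma\Rightarrow\Delta$; (R$\wedge$) $\Gamma\Rightarrow\Delta,w\Vvdash A$ and $\Gamma\Rightarrow\Delta,w\Vvdash B$ / $\Gamma\Rightarrow\Delta,w\Vvdash A\wedge B$; (L$\vee$) $w\Vvdash A,\Gamma\Rightarrow\Delta$ and $w\Vvdash B,\Gamma\Rightarrow\Delta$ / $w\Vvdash A\vee B,\Gamma\Rightarrow\Delta$; (R$\vee$) $\Gamma\Rightarrow\Delta,w\Vvdash A,w\Vvdash B$ / $\Gamma\Rightarrow\Delta,w\Vvdash A\vee B$; (L$\to$) $\Gamma\Rightarrow\Delta,w\Vvdash A$ and $w\Vvdash B,\Gamma\Rightarrow\Delta$ / $w\Vvdash A\to B,\Gamma\Rightarrow\Delta$; (R$\to$) $w\Vvdash A,\Gamma\Rightarrow\Delta,w\Vvdash B$ / $\Gamma\Rightarrow\Delta,w\Vvdash A\to B$; (L:) $v\Vvdash A,w\Vvdash t:A,wRv,\Gamma\Rightarrow\Delta$ / $w\Vvdash t:A,wRv,\Gamma\Rightarrow\Delta$; (R:) $wRv,wE(t,A),\Gamma\Rightarrow\Delta,v\Vvdash A$ / $wE(t,A),\Gamma\Rightarrow\Delta,w\Vvdash t:A$, where $v$ does not occur in the conclusion; (E) $wE(t,A),w\Vvdash t:A,\Gamma\Rightarrow\Delta$ / $w\Vvdash t:A,\Gamma\Rightarrow\Delta$;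 (El+) $wE(s+t,A),wE(t,A),\Gamma\Rightarrow\Delta$ / $wE(t,A),\Gamma\Rightarrow\Delta$; (Er+) $wE(t+s,A),wE(t,A),\Gamma\Rightarrow\Delta$ / $wE(t,A),\Gamma\Rightarrow\Delta$; (E$\cdot$) $wE(s\cdot t,B),wE(s,A\to B),wE(t,A),\Gamma\Rightarrow\Delta$ / $wE(s,A\to B),wE(t,A),\Gamma\Rightarrow\Delta$; (E!) $wE(!t,t:A),wE(t,A),\Gamma\Rightarrow\Delta$ / $wE(t,A),\Gamma\Rightarrow\Delta$; (Mon) $vE(t,A),wE(t,A),wRv,\Gamma\Rightarrow\Delta$ / $wE(t,A),wRv,\Gamma\Rightarrow\Delta$; (AN) $wE(c,A),\Gamma\Rightarrow\Delta$ / $\Gamma\Rightarrow\Delta$, for $c:A\in\mathsf{CS}$; (Ref) $wRw,\Gamma\Rightarrow\Delta$ / $\Gamma\Rightarrow\Delta$; (Trans) $wRu,wRv,vRu,\Gamma\Rightarrow\Delta$ / $wRv,vRu,\Gamma\Rightarrow\Delta$. *)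

theory Defs
  imports "HOL-Library.Multiset" "HOL-Library.Nat_Bijection"
begin

datatype jterm =
    JVar nat
  | JConst nat
  | App jterm jterm
  | Plus jterm jterm
  | Bang jterm

datatype fm =
    PVar nat
  | Bot
  | Neg fm
  | And fm fm
  | Or fm fm
  | Imp fm fm
  | Just jterm fm

text \<open>Propositional evaluation treats formulas \<open>t:A\<close> as atoms, so \<open>tautology\<close> holds exactly of the
  substitution instances, in the language of LP, of classical propositional tautologies.\<close>

primrec prop_eval :: "(fm \<Rightarrow> bool) \<Rightarrow> fm \<Rightarrow> bool" where
  "prop_eval I (PVar p) = I (PVar p)"
| "prop_eval I Bot = False"
| "prop_eval I (Neg A) = (\<not> prop_eval I A)"
| "prop_eval I (And A B) = (prop_eval I A \<and> prop_eval I B)"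
| "prop_eval I (Or A B) = (prop_eval I A \<or> prop_eval I B)"
| "prop_eval I (Imp A B) = (prop_eval I A \<longrightarrow> prop_eval I B)"
| "prop_eval I (Just t A) = I (Just t A)"

definition tautology :: "fm \<Rightarrow> bool" where
  "tautology A \<longleftrightarrow> (\<forall>I. prop_eval I A)"

inductive LP_axiom :: "fm \<Rightarrow> bool" where
  Taut: "tautology A \<Longrightarrow> LP_axiom A"
| SumL: "LP_axiom (Imp (Just s A) (Just (Plus s t) A))"
| SumR: "LP_axiom (Imp (Just s A) (Just (Plus t s) A))"
| Appl: "LP_axiom (Imp (Just s (Imp A B)) (Imp (Just t A) (Just (App s t) B)))"
| Fact: "LP_axiom (Imp (Just t A) A)"
| PosIntro: "LP_axiom (Imp (Just t A) (Just (Bang t) (Just t A)))"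

definition constant_specification :: "fm set \<Rightarrow> bool" where
  "constant_specification CS \<longleftrightarrow> (\<forall>F\<in>CS. \<exists>c A. F = Just (JConst c) A \<and> LP_axiom A)"

type_synonym label = nat

datatype lform =
    Forces label fm
  | Rel label label
  | Ev label jterm fm

primrec labels :: "lform \<Rightarrow> label set" where
  "labels (Forces w A) = {w}"
| "labels (Rel w v) = {w, v}"
| "labels (Ev w t A) = {w}"

inductive G3LP :: "fm set \<Rightarrow> lform multiset \<Rightarrow> lform multiset \<Rightarrow> bool" for CS where
  AxP: "G3LP CS (add_mset (Forces w (PVar p)) \<Gamma>) (add_mset (Forces w (PVar p)) \<Delta>)"
| AxBot: "G3LP CS (add_mset (Forces w Bot) \<Gamma>) \<Delta>"
| AxR: "G3LP CS (add_mset (Rel w v) \<Gamma>) (add_mset (Rel w v) \<Delta>)"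
| AxE: "G3LP CS (add_mset (Ev w t A) \<Gamma>) (add_mset (Ev w t A) \<Delta>)"
| LNeg: "G3LP CS \<Gamma> (add_mset (Forces w A) \<Delta>)
    \<Longrightarrow> G3LP CS (add_mset (Forces w (Neg A)) \<Gamma>) \<Delta>"
| RNeg: "G3LP CS (add_mset (Forces w A) \<Gamma>) \<Delta>
    \<Longrightarrow> G3LP CS \<Gamma> (add_mset (Forces w (Neg A)) \<Delta>)"
| LAnd: "G3LP CS (add_mset (Forces w A) (add_mset (Forces w B) \<Gamma>)) \<Delta>
    \<Longrightarrow> G3LP CS (add_mset (Forces w (And A B)) \<Gamma>) \<Delta>"
| RAnd: "\<lbrakk>G3LP CS \<Gamma> (add_mset (Forces w A) \<Delta>); G3LP CS \<Gamma> (add_mset (Forces w B) \<Delta>)\<rbrakk>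
    \<Longrightarrow> G3LP CS \<Gamma> (add_mset (Forces w (And A B)) \<Delta>)"
| LOr: "\<lbrakk>G3LP CS (add_mset (Forces w A) \<Gamma>) \<Delta>; G3LP CS (add_mset (Forces w B) \<Gamma>) \<Delta>\<rbrakk>
    \<Longrightarrow> G3LP CS (add_mset (Forces w (Or A B)) \<Gamma>) \<Delta>"
| ROr: "G3LP CS \<Gamma> (add_mset (Forces w A) (add_mset (Forces w B) \<Delta>))
    \<Longrightarrow> G3LP CS \<Gamma> (add_mset (Forces w (Or A B)) \<Delta>)"
| LImp: "\<lbrakk>G3LP CS \<Gamma> (add_mset (Forces w A) \<Delta>); G3LP CS (add_mset (Forces w B) \<Gamma>) \<Delta>\<rbrakk>
    \<Longrightarrow> G3LP CS (add_mset (Forces w (Imp A B)) \<Gamma>) \<Delta>"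
| RImp: "G3LP CS (add_mset (Forces w A) \<Gamma>) (add_mset (Forces w B) \<Delta>)
    \<Longrightarrow> G3LP CS \<Gamma> (add_mset (Forces w (Imp A B)) \<Delta>)"
| LJust: "G3LP CS (add_mset (Forces v A) (add_mset (Forces w (Just t A)) (add_mset (Rel w v) \<Gamma>))) \<Delta>
    \<Longrightarrow> G3LP CS (add_mset (Forces w (Just t A)) (add_mset (Rel w v) \<Gamma>)) \<Delta>"
| RJust: "\<lbrakk>G3LP CS (add_mset (Rel w v) (add_mset (Ev w t A) \<Gamma>)) (add_mset (Forces v A) \<Delta>);
      \<forall>x \<in># add_mset (Ev w t A) \<Gamma> + add_mset (Forces w (Just t A)) \<Delta>. v \<notin> labels x\<rbrakk>
    \<Longrightarrow> G3LP CS (add_mset (Ev w t A) \<Gamma>) (add_mset (Forces w (Just t A)) \<Delta>)"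
| E: "G3LP CS (add_mset (Ev w t A) (add_mset (Forces w (Just t A)) \<Gamma>)) \<Delta>
    \<Longrightarrow> G3LP CS (add_mset (Forces w (Just t A)) \<Gamma>) \<Delta>"
| ElPlus: "G3LP CS (add_mset (Ev w (Plus s t) A) (add_mset (Ev w t A) \<Gamma>)) \<Delta>
    \<Longrightarrow> G3LP CS (add_mset (Ev w t A) \<Gamma>) \<Delta>"
| ErPlus: "G3LP CS (add_mset (Ev w (Plus t s) A) (add_mset (Ev w t A) \<Gamma>)) \<Delta>
    \<Longrightarrow> G3LP CS (add_mset (Ev w t A) \<Gamma>) \<Delta>"
| EApp: "G3LP CS (add_mset (Ev w (App s t) B)
                   (add_mset (Ev w s (Imp A B)) (add_mset (Ev w t A) \<Gamma>))) \<Delta>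
    \<Longrightarrow> G3LP CS (add_mset (Ev w s (Imp A B)) (add_mset (Ev w t A) \<Gamma>)) \<Delta>"
| EBang: "G3LP CS (add_mset (Ev w (Bang t) (Just t A)) (add_mset (Ev w t A) \<Gamma>)) \<Delta>
    \<Longrightarrow> G3LP CS (add_mset (Ev w t A) \<Gamma>) \<Delta>"
| Mon: "G3LP CS (add_mset (Ev v t A) (add_mset (Ev w t A) (add_mset (Rel w v) \<Gamma>))) \<Delta>
    \<Longrightarrow> G3LP CS (add_mset (Ev w t A) (add_mset (Rel w v) \<Gamma>)) \<Delta>"
| AN: "\<lbrakk>G3LP CS (add_mset (Ev w (JConst c) A) \<Gamma>) \<Delta>; Just (JConst c) A \<in> CS\<rbrakk>
    \<Longrightarrow> G3LP CS \<Gamma> \<Delta>"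
| Ref: "G3LP CS (add_mset (Rel w w) \<Gamma>) \<Delta> \<Longrightarrow> G3LP CS \<Gamma> \<Delta>"
| Trans: "G3LP CS (add_mset (Rel w u) (add_mset (Rel w v) (add_mset (Rel v u) \<Gamma>))) \<Delta>
    \<Longrightarrow> G3LP CS (add_mset (Rel w v) (add_mset (Rel v u) \<Gamma>)) \<Delta>"

text \<open>\<open>recursive n f\<close>: the total function \<open>f\<close>, restricted to argument lists of length \<open>n\<close>, is an
  \<open>n\<close>-ary general recursive function. Minimization is applied only to regular functions (those for
  which a zero always exists), so every function in the class is total; values of \<open>f\<close> on lists of
  any other length carry no information.\<close>

inductive recursive :: "nat \<Rightarrow> (nat list \<Rightarrow> nat) \<Rightarrow> bool" where
  zero: "recursive n (\<lambda>xs. 0)"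
| succ: "recursive 1 (\<lambda>xs. Suc (xs ! 0))"
| proj: "i < n \<Longrightarrow> recursive n (\<lambda>xs. xs ! i)"
| comp: "\<lbrakk>recursive (length gs) f; \<forall>g\<in>set gs. recursive n g\<rbrakk>
    \<Longrightarrow> recursive n (\<lambda>xs. f (map (\<lambda>g. g xs) gs))"
| prim_rec: "\<lbrakk>recursive n g; recursive (n + 2) h\<rbrakk>
    \<Longrightarrow> recursive (n + 1)
          (\<lambda>xs. rec_nat (g (tl xs)) (\<lambda>y r. h (y # r # tl xs)) (hd xs))"
| minim: "\<lbrakk>recursive (n + 1) f; \<forall>xs. length xs = n \<longrightarrow> (\<exists>y. f (y # xs) = 0)\<rbrakk>
    \<Longrightarrow> recursive n (\<lambda>xs. LEAST y. f (y # xs) = 0)"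

text \<open>\<open>code\<close> is the Goedel numbering through which instances are presented.\<close>

definition decidable_via :: "('a \<Rightarrow> nat) \<Rightarrow> ('a \<Rightarrow> bool) \<Rightarrow> bool" where
  "decidable_via code P \<longleftrightarrow>
     (\<exists>f. recursive 1 f \<and> (\<forall>x. f [code x] = (if P x then 1 else 0)))"

primrec jterm_code :: "jterm \<Rightarrow> nat" where
  "jterm_code (JVar x) = prod_encode (0, x)"
| "jterm_code (JConst c) = prod_encode (1, c)"
| "jterm_code (App s t) = prod_encode (2, prod_encode (jterm_code s, jterm_code t))"
| "jterm_code (Plus s t) = prod_encode (3, prod_encode (jterm_code s, jterm_code t))"
| "jterm_code (Bang t) = prod_encode (4, jterm_code t)"

primrec fm_code :: "fm \<Rightarrow> nat" where
  "fm_code (PVar p) = prod_encode (0, p)"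
| "fm_code Bot = prod_encode (1, 0)"
| "fm_code (Neg A) = prod_encode (2, fm_code A)"
| "fm_code (And A B) = prod_encode (3, prod_encode (fm_code A, fm_code B))"
| "fm_code (Or A B) = prod_encode (4, prod_encode (fm_code A, fm_code B))"
| "fm_code (Imp A B) = prod_encode (5, prod_encode (fm_code A, fm_code B))"
| "fm_code (Just t A) = prod_encode (6, prod_encode (jterm_code t, fm_code A))"

primrec lform_code :: "lform \<Rightarrow> nat" where
  "lform_code (Forces w A) = prod_encode (0, prod_encode (w, fm_code A))"
| "lform_code (Rel w v) = prod_encode (1, prod_encode (w, v))"
| "lform_code (Ev w t A) = prod_encode (2, prod_encode (w, prod_encode (jterm_code t, fm_code A)))"

text \<open>A sequent is presented as input by a pair of lists enumerating its two multisets with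
  multiplicity. The order is arbitrary, and a decider must answer correctly for every enumeration.\<close>

definition sequent_code :: "lform list \<times> lform list \<Rightarrow> nat" where
  "sequent_code = (\<lambda>(xs, ys).
     prod_encode (list_encode (map lform_code xs), list_encode (map lform_code ys)))"

end

theory Submission
  imports Defs "HOL-Library.Countable"
begin

text \<open>A sequent is derivable iff it holds in all Kripke models with evidence. For completeness, a
  fair backward search through underivable sequents yields in the limit a pair of sets of labeled
  formulas that is itself a model on the labels. To decide validity, take finite sets \<open>T\<close>, \<open>S\<close> of
  terms and formulas containing the sequent and the constant specification, and a finite set \<open>V\<close> of
  pairs \<open>(t, A)\<close> containing all evidence that can arise for terms in \<open>T\<close>. A countermodel can be
  filtered through \<open>S\<close> and \<open>V\<close> to a finite one. Conversely, finite data that are closed only with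
  respect to terms in \<open>T\<close> extend to a full model, because the evidence rules produce evidence for
  a term from evidence for its subterms. So derivability means that a bounded search for finite
  countermodels fails; the sets bounding the search are found by minimization.\<close>

section \<open>Computable functions and decidable predicates\<close>

text \<open>Backward proof search has no evident bound: \<open>ElPlus\<close>, \<open>ErPlus\<close>
  and \<open>EBang\<close> build ever larger terms, \<open>Ref\<close> may name any label, and
  \<open>RJust\<close> creates new ones. Hence the route through models. The delicate point of the
  filtration is that atoms \<open>Rel w v\<close> may stand on either side of the sequent, so
  accessibility from its labels must be neither lost nor added; this is why a finite world remembers
  the labels that see it. A formula \<open>t:A\<close> in \<open>S\<close> brings a pair into
  \<open>V\<close>, and a pair in \<open>V\<close> brings a formula into \<open>S\<close>; this
  mutual closure stays finite because beyond an initial stock of formulas only \<open>!\<close>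
  yields new ones, along the terms of \<open>T\<close>. Finiteness of the specification lets it
  enter the checks as one number \<open>K\<close>. On the computability side, no recursion over
  syntax is programmed. Sets of numbers are guessed, and checks with bounded quantifiers certify
  that they are closed and consist of codes. One unbounded search finds these sets; they then bound
  the numerical size of the countermodels to be tried.\<close>

definition pfst :: "nat \<Rightarrow> nat" where "pfst z = fst (prod_decode z)"
definition psnd :: "nat \<Rightarrow> nat" where "psnd z = snd (prod_decode z)"

lemma pfst_pair [simp]: "pfst (prod_encode (a, b)) = a"
  by (simp add: pfst_def)

lemma psnd_pair [simp]: "psnd (prod_encode (a, b)) = b"
  by (simp add: psnd_def)

lemma pair_eta [simp]: "prod_encode (pfst z, psnd z) = z"
  by (simp add: pfst_def psnd_def)

text \<open>\<open>recursive\<close> concerns functions on lists, whose values off the intended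
  length are accidental. Agreement with a recursive function on lists of the right length depends on
  the numerical function alone.\<close>

definition computable :: "(nat \<Rightarrow> nat) \<Rightarrow> bool" where
  "computable f \<longleftrightarrow> (\<exists>g. recursive 1 g \<and> (\<forall>x. g [x] = f x))"

definition computable2 :: "(nat \<Rightarrow> nat \<Rightarrow> nat) \<Rightarrow> bool" where
  "computable2 f \<longleftrightarrow> (\<exists>g. recursive 2 g \<and> (\<forall>x y. g [x, y] = f x y))"

section \<open>Composition, recursion and arithmetic in one and two arguments\<close>

lemma computable_comp:
  assumes "computable f" "computable g"
  shows "computable (\<lambda>e. f (g e))"
proof -
  obtain f' g' where f': "recursive 1 f'" "\<And>x. f' [x] = f x"
    and g': "recursive 1 g'" "\<And>x. g' [x] = g x"
    using assms unfolding computable_def by blast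
  have "recursive 1 (\<lambda>xs. f' (map (\<lambda>h. h xs) [g']))"
    by (rule recursive.comp) (use f' g' in auto)
  then show ?thesis
    unfolding computable_def by (intro exI, intro conjI, assumption) (simp add: f' g')
qed

lemma computable2_comp:
  assumes "computable2 f" "computable g" "computable h"
  shows "computable (\<lambda>e. f (g e) (h e))"
proof -
  obtain f' g' h' where f': "recursive 2 f'" "\<And>x y. f' [x, y] = f x y"
    and g': "recursive 1 g'" "\<And>x. g' [x] = g x"
    and h': "recursive 1 h'" "\<And>x. h' [x] = h x"
    using assms unfolding computable_def computable2_def by blast
  have "recursive 1 (\<lambda>xs. f' (map (\<lambda>k. k xs) [g', h']))"
    by (rule recursive.comp) (use f' g' h' in \<open>auto simp: numeral_2_eq_2\<close>)
  then show ?thesis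
    unfolding computable_def by (intro exI, intro conjI, assumption) (simp add: f' g' h')
qed

lemma computable2_lift:
  assumes "computable f" "computable2 g"
  shows "computable2 (\<lambda>x y. f (g x y))"
proof -
  obtain f' g' where f': "recursive 1 f'" "\<And>x. f' [x] = f x"
    and g': "recursive 2 g'" "\<And>x y. g' [x, y] = g x y"
    using assms unfolding computable_def computable2_def by blast
  have "recursive 2 (\<lambda>xs. f' (map (\<lambda>h. h xs) [g']))"
    by (rule recursive.comp) (use f' g' in auto)
  then show ?thesis
    unfolding computable2_def by (intro exI, intro conjI, assumption) (simp add: f' g')
qed

lemma computable2_comp2:
  assumes "computable2 f" "computable2 g" "computable2 h"
  shows "computable2 (\<lambda>x y. f (g x y) (h x y))"
proof -
  obtain f' g' h' where f': "recursive 2 f'" "\<And>x y. f' [x, y] = f x y"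
    and g': "recursive 2 g'" "\<And>x y. g' [x, y] = g x y"
    and h': "recursive 2 h'" "\<And>x y. h' [x, y] = h x y"
    using assms unfolding computable2_def by blast
  have "recursive 2 (\<lambda>xs. f' (map (\<lambda>k. k xs) [g', h']))"
    by (rule recursive.comp) (use f' g' h' in \<open>auto simp: numeral_2_eq_2\<close>)
  then show ?thesis
    unfolding computable2_def by (intro exI, intro conjI, assumption) (simp add: f' g' h')
qed

lemma computable_id: "computable (\<lambda>e. e)"
  unfolding computable_def using recursive.proj[of 0 1] by auto

lemma computable2_fst: "computable2 (\<lambda>x y. x)"
  unfolding computable2_def using recursive.proj[of 0 2] by auto

lemma computable2_snd: "computable2 (\<lambda>x y. y)"
  unfolding computable2_def using recursive.proj[of 1 2] by auto

lemma computable_Suc_fun: "computable Suc"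
  unfolding computable_def using recursive.succ by auto

lemma computable_Suc: "computable f \<Longrightarrow> computable (\<lambda>e. Suc (f e))"
  by (rule computable_comp[OF computable_Suc_fun])

lemma computable_const: "computable (\<lambda>e. c)"
proof (induction c)
  case 0
  then show ?case unfolding computable_def using recursive.zero[of 1] by auto
next
  case (Suc c)
  then show ?case by (rule computable_Suc)
qed

lemma computable_rec0:
  assumes "computable2 h"
  shows "computable (\<lambda>x. rec_nat c h x)"
proof -
  obtain h' where h': "recursive 2 h'" "\<And>x y. h' [x, y] = h x y"
    using assms unfolding computable2_def by blast
  \<comment> \<open>Recursion without parameters takes its initial value from a function of arity
    zero, so constants are needed at that arity too.\<close>
  have c: "recursive 0 (\<lambda>xs. c)"
  proof (induction c)
    case 0
    then show ?case by (rule recursive.zero)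
  next
    case (Suc c)
    have "recursive 0 (\<lambda>xs. (\<lambda>ys. Suc (ys ! 0)) (map (\<lambda>g. g xs) [\<lambda>xs. c]))"
      by (rule recursive.comp) (use Suc recursive.succ in auto)
    then show ?case by simp
  qed
  have "recursive (0 + 1)
     (\<lambda>xs. rec_nat ((\<lambda>_. c) (tl xs)) (\<lambda>y r. h' (y # r # tl xs)) (hd xs))"
    by (rule recursive.prim_rec[OF c]) (use h' in \<open>simp add: numeral_2_eq_2\<close>)
  then show ?thesis
    unfolding computable_def by (intro exI, intro conjI, simp) (simp add: h')
qed

lemma computable2_rec:
  assumes "computable g" and h: "computable2 h"
  shows "computable2 (\<lambda>x y. rec_nat (g y) (\<lambda>_. h y) x)"
proof -
  obtain g' h' where g': "recursive 1 g'" "\<And>x. g' [x] = g x"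
    and h': "recursive 2 h'" "\<And>x y. h' [x, y] = h x y"
    using assms unfolding computable_def computable2_def by blast
  \<comment> \<open>The step function receives counter, accumulator and parameter in this order; the
    parameter is at index 2, the accumulator at index 1.\<close>
  have "recursive 3 (\<lambda>xs. h' (map (\<lambda>k. k xs) [\<lambda>xs. xs ! 2, \<lambda>xs. xs ! 1]))"
    by (rule recursive.comp) (use h' recursive.proj in \<open>auto simp: numeral_2_eq_2\<close>)
  then have h3: "recursive (1 + 2) (\<lambda>xs. h' [xs ! 2, xs ! 1])" by (simp add: eval_nat_numeral)
  have "recursive (1 + 1)
     (\<lambda>xs. rec_nat (g' (tl xs)) (\<lambda>y r. (\<lambda>xs. h' [xs ! 2, xs ! 1]) (y # r # tl xs)) (hd xs))"
    by (rule recursive.prim_rec[OF g'(1) h3])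
  then show ?thesis
    unfolding computable2_def by (intro exI, intro conjI, simp add: numeral_2_eq_2) (simp add: h' g')
qed

lemma computable2_add: "computable2 (+)"
proof -
  have "computable2 (\<lambda>x y. rec_nat y (\<lambda>_. (\<lambda>_ r. Suc r) y) x)"
    by (rule computable2_rec[OF computable_id computable2_lift[OF computable_Suc_fun computable2_snd]])
  moreover have "rec_nat y (\<lambda>_ r. Suc r) x = x + y" for x y :: nat
    by (induction x) auto
  ultimately show ?thesis by simp
qed

lemma computable_pred: "computable (\<lambda>x. x - 1)"
proof -
  have "computable (\<lambda>x. rec_nat 0 (\<lambda>x y. x) x)"
    by (rule computable_rec0[OF computable2_fst])
  moreover have "rec_nat 0 (\<lambda>x y. x) x = x - 1" for x :: nat
    by (cases x) auto
  ultimately show ?thesis by simp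
qed

lemma computable2_diff: "computable2 (-)"
proof -
  have "computable2 (\<lambda>x y. rec_nat y (\<lambda>_. (\<lambda>_ r. r - 1) y) x)"
    by (rule computable2_rec[OF computable_id computable2_lift[OF computable_pred computable2_snd]])
  moreover have "rec_nat y (\<lambda>_ r. r - 1) x = y - x" for x y :: nat
    by (induction x) auto
  ultimately have "computable2 (\<lambda>x y. y - x)" by simp
  \<comment> \<open>The recursion runs on its first argument, here the subtrahend, so the arguments
    are exchanged.\<close>
  from computable2_comp2[OF this computable2_snd computable2_fst] show ?thesis by simp
qed

lemma computable2_mult: "computable2 (*)"
proof -
  have "computable2 (\<lambda>x y. rec_nat 0 (\<lambda>_. (\<lambda>y r. y + r) y) x)"
    by (rule computable2_rec[OF computable_const computable2_add])
  moreover have "rec_nat 0 (\<lambda>_ r. y + r) x = x * y" for x y :: nat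
    by (induction x) auto
  ultimately show ?thesis by simp
qed

lemma computable_triangle: "computable triangle"
proof -
  have "computable (\<lambda>x. rec_nat 0 (\<lambda>x r. r + Suc x) x)"
    by (intro computable_rec0 computable2_comp2[OF computable2_add] computable2_snd
        computable2_lift[OF computable_Suc_fun] computable2_fst)
  moreover have "rec_nat 0 (\<lambda>x r. r + Suc x) x = triangle x" for x
    by (induction x) auto
  ultimately show ?thesis by (metis (no_types, lifting) ext)
qed

lemmas computable_add = computable2_comp[OF computable2_add]
  and computable_diff = computable2_comp[OF computable2_diff]
  and computable_mult = computable2_comp[OF computable2_mult]

lemma computable_pair:
  assumes "computable f" "computable g"
  shows "computable (\<lambda>e. prod_encode (f e, g e))"
  unfolding prod_encode_def
  by (simp, intro computable_add computable_comp[OF computable_triangle] assms)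

lemma computable_min2:
  assumes "computable2 f" "\<And>x. \<exists>y. f y x = 0"
  shows "computable (\<lambda>x. LEAST y. f y x = 0)"
proof -
  obtain f' where f': "recursive 2 f'" "\<And>x y. f' [x, y] = f x y"
    using assms unfolding computable2_def by blast
  have "\<forall>xs. length xs = 1 \<longrightarrow> (\<exists>y. f' (y # xs) = 0)"
    using assms(2) f'(2) by (metis length_0_conv length_Suc_conv One_nat_def)
  then have "recursive 1 (\<lambda>xs. LEAST y. f' (y # xs) = 0)"
    using recursive.minim[of 1 f'] f'(1) by (simp add: numeral_2_eq_2)
  then show ?thesis
    unfolding computable_def by (intro exI, intro conjI, assumption) (simp add: f')
qed

section \<open>Inverting the Cantor pairing function\<close>

lemma le_triangle: "n \<le> triangle n"
  by (induction n) auto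

lemma mono_triangle: "m \<le> n \<Longrightarrow> triangle m \<le> triangle n"
  by (induction n) (auto simp: le_Suc_eq)

text \<open>\<open>prod_encode (a, b)\<close> is \<open>triangle (a + b) + a\<close>, so
  \<open>a + b\<close> is the index of the last triangular number not exceeding the code. By
  truncated subtraction the equation expresses \<open>z < triangle (Suc k)\<close> in the form that
  minimization requires.\<close>

lemma triangle_root:
  "(LEAST k. Suc z - triangle (Suc k) = 0) = pfst z + psnd z"
proof -
  obtain a b where z: "z = prod_encode (a, b)"
    by (metis pair_eta)
  have "(LEAST k. Suc z - triangle (Suc k) = 0) = a + b"
  proof (rule Least_equality)
    show "Suc z - triangle (Suc (a + b)) = 0"
      by (simp add: z prod_encode_def)
  next
    fix k assume "Suc z - triangle (Suc k) = 0"
    then have *: "triangle (a + b) < triangle (Suc k)"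
      by (simp add: z prod_encode_def)
    show "a + b \<le> k"
    proof (rule ccontr)
      assume "\<not> a + b \<le> k"
      then have "triangle (Suc k) \<le> triangle (a + b)"
        by (intro mono_triangle) simp
      then show False using * by simp
    qed
  qed
  then show ?thesis by (simp add: z)
qed

lemma computable_pfst_plus_psnd: "computable (\<lambda>z. pfst z + psnd z)"
proof -
  have "computable2 (\<lambda>k z. Suc z - triangle (Suc k))"
    by (intro computable2_comp2[OF computable2_diff] computable2_lift[OF computable_triangle]
        computable2_lift[OF computable_Suc_fun] computable2_fst computable2_snd)
  moreover have "\<exists>k. Suc z - triangle (Suc k) = 0" for z
    using le_triangle[of "Suc z"] by (metis diff_is_0_eq)
  ultimately have "computable (\<lambda>z. LEAST k. Suc z - triangle (Suc k) = 0)"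
    by (rule computable_min2)
  then show ?thesis by (simp only: triangle_root)
qed

lemma computable_pfst_fun: "computable pfst"
proof -
  have "z - triangle (pfst z + psnd z) = pfst z" for z
    by (subst (1) pair_eta[symmetric]) (simp add: prod_encode_def del: pair_eta)
  moreover have "computable (\<lambda>z. z - triangle (pfst z + psnd z))"
    by (intro computable_diff computable_id computable_comp[OF computable_triangle]
        computable_pfst_plus_psnd)
  ultimately show ?thesis by simp
qed

lemma computable_psnd_fun: "computable psnd"
proof -
  have "computable (\<lambda>z. (pfst z + psnd z) - pfst z)"
    by (rule computable_diff[OF computable_pfst_plus_psnd computable_pfst_fun])
  then show ?thesis by simp
qed

lemmas computable_pfst = computable_comp[OF computable_pfst_fun]
  and computable_psnd = computable_comp[OF computable_psnd_fun]

text \<open>With pairing and both projections available, a binary function can be treated as a unary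
  one on pairs, and the closure rules below need only one argument.\<close>

lemma computable2I:
  assumes "computable (\<lambda>z. f (pfst z) (psnd z))"
  shows "computable2 f"
proof -
  obtain f' where f': "recursive 1 f'" "\<And>z. f' [z] = f (pfst z) (psnd z)"
    using assms unfolding computable_def by blast
  have "computable2 (\<lambda>x y. triangle (x + y) + x)"
    by (intro computable2_comp2[OF computable2_add] computable2_lift[OF computable_triangle]
        computable2_fst computable2_snd)
  then have pair: "computable2 (\<lambda>x y. prod_encode (x, y))"
    by (simp add: prod_encode_def)
  from computable2_lift[OF assms pair] show ?thesis by simp
qed

text \<open>A step function reading its counter is reduced to the parameter-only recursion
  \<open>computable2_rec\<close> by carrying the counter in the accumulator.\<close>

lemma computable_rec:
  assumes "computable g" "computable (\<lambda>z. h (pfst z) (pfst (psnd z)) (psnd (psnd z)))" "computable n"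
  shows "computable (\<lambda>e. rec_nat (g e) (\<lambda>y r. h y r e) (n e))"
proof -
  define st where "st e r = prod_encode (Suc (pfst r), h (pfst r) (psnd r) e)" for e r
  have "computable (\<lambda>z. prod_encode (pfst (psnd z), prod_encode (psnd (psnd z), pfst z)))"
    by (intro computable_pair computable_pfst computable_psnd computable_id)
  from computable_comp[OF assms(2) this]
  have "computable (\<lambda>z. st (pfst z) (psnd z))"
    unfolding st_def
    by (simp, intro computable_pair computable_Suc computable_pfst computable_psnd computable_id)
  then have "computable2 st" by (rule computable2I)
  from computable2_rec[OF computable_pair[OF computable_const[of 0] assms(1)] this]
  have "computable2 (\<lambda>x y. rec_nat (prod_encode (0, g y)) (\<lambda>_. st y) x)" .
  from computable_psnd[OF computable2_comp[OF this assms(3) computable_id]]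
  have "computable (\<lambda>e. psnd (rec_nat (prod_encode (0, g e)) (\<lambda>_. st e) (n e)))" .
  moreover have "rec_nat (prod_encode (0, g e)) (\<lambda>_. st e) k
      = prod_encode (k, rec_nat (g e) (\<lambda>y r. h y r e) k)" for e k
    by (induction k) (auto simp: st_def)
  ultimately show ?thesis by simp
qed

section \<open>Decidable predicates and bounded quantifiers\<close>

definition dec :: "(nat \<Rightarrow> bool) \<Rightarrow> bool" where
  "dec P \<longleftrightarrow> computable (\<lambda>e. if P e then 1 else 0)"

lemma dec_comp: "dec P \<Longrightarrow> computable f \<Longrightarrow> dec (\<lambda>e. P (f e))"
  unfolding dec_def by (rule computable_comp)

lemma dec_not: "dec P \<Longrightarrow> dec (\<lambda>e. \<not> P e)"
proof -
  assume "dec P"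
  then have "computable (\<lambda>e. 1 - (if P e then 1 else 0))"
    unfolding dec_def by (intro computable_diff computable_const)
  moreover have "(\<lambda>e. 1 - (if P e then 1 else 0)) = (\<lambda>e. if \<not> P e then 1 else 0 :: nat)"
    by auto
  ultimately show ?thesis unfolding dec_def by simp
qed

lemma dec_conj: "dec P \<Longrightarrow> dec Q \<Longrightarrow> dec (\<lambda>e. P e \<and> Q e)"
proof -
  assume "dec P" "dec Q"
  then have "computable (\<lambda>e. (if P e then 1 else 0) * (if Q e then 1 else 0))"
    unfolding dec_def by (rule computable_mult)
  moreover have "(\<lambda>e. (if P e then 1 else 0) * (if Q e then 1 else 0))
      = (\<lambda>e. if P e \<and> Q e then 1 else 0 :: nat)"
    by auto
  ultimately show ?thesis unfolding dec_def by simp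
qed

lemma dec_disj:
  assumes "dec P" "dec Q"
  shows "dec (\<lambda>e. P e \<or> Q e)"
proof -
  have "dec (\<lambda>e. \<not> (\<not> P e \<and> \<not> Q e))"
    by (rule dec_not, rule dec_conj; rule dec_not, fact)
  then show ?thesis by (simp only: de_Morgan_conj not_not)
qed

lemma dec_imp:
  assumes "dec P" "dec Q"
  shows "dec (\<lambda>e. P e \<longrightarrow> Q e)"
proof -
  have "dec (\<lambda>e. \<not> P e \<or> Q e)"
    by (rule dec_disj, rule dec_not, fact, fact)
  then show ?thesis by (simp only: imp_conv_disj)
qed

lemma dec_iff:
  assumes "dec P" "dec Q"
  shows "dec (\<lambda>e. P e \<longleftrightarrow> Q e)"
proof -
  have "dec (\<lambda>e. (P e \<longrightarrow> Q e) \<and> (Q e \<longrightarrow> P e))"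
    by (rule dec_conj; rule dec_imp; fact)
  then show ?thesis by (simp only: iff_conv_conj_imp)
qed

lemma dec_const: "dec (\<lambda>e. c)"
  unfolding dec_def by (rule computable_const)

lemma computable_if:
  assumes "dec P" "computable f" "computable g"
  shows "computable (\<lambda>e. if P e then f e else g e)"
proof -
  have "computable (\<lambda>e. (if P e then 1 else 0) * f e + (1 - (if P e then 1 else 0)) * g e)"
    using assms unfolding dec_def
    by (intro computable_add computable_mult computable_diff computable_const)
  moreover have "(\<lambda>e. (if P e then 1 else 0) * f e + (1 - (if P e then 1 else 0)) * g e)
      = (\<lambda>e. if P e then f e else g e)"
    by auto
  ultimately show ?thesis by simp
qed

lemma dec_le: "computable f \<Longrightarrow> computable g \<Longrightarrow> dec (\<lambda>e. f e \<le> g e)"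
proof -
  assume "computable f" "computable g"
  then have "computable (\<lambda>e. 1 - (f e - g e))"
    by (intro computable_diff computable_const)
  moreover have "(\<lambda>e. 1 - (f e - g e)) = (\<lambda>e. if f e \<le> g e then 1 else 0)"
    by auto
  ultimately show ?thesis unfolding dec_def by simp
qed

lemma dec_less:
  assumes "computable f" "computable g"
  shows "dec (\<lambda>e. f e < g e)"
proof -
  have "dec (\<lambda>e. \<not> g e \<le> f e)"
    by (rule dec_not, rule dec_le; fact)
  then show ?thesis by (simp only: not_le)
qed

lemma dec_eq:
  assumes "computable f" "computable g"
  shows "dec (\<lambda>e. f e = g e)"
proof -
  have "dec (\<lambda>e. f e \<le> g e \<and> g e \<le> f e)"
    by (rule dec_conj; rule dec_le; fact)
  then show ?thesis by (simp only: eq_iff)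
qed

lemma computable_Least:
  assumes "dec (\<lambda>z. P (pfst z) (psnd z))" "\<And>e. \<exists>y. P y e"
  shows "computable (\<lambda>e. LEAST y. P y e)"
proof -
  have "computable2 (\<lambda>y e. if \<not> P y e then 1 else 0)"
    using dec_not[OF assms(1)] unfolding dec_def by (rule computable2I)
  from computable_min2[OF this] assms(2)
  have "computable (\<lambda>e. LEAST y. (if \<not> P y e then 1 else 0 :: nat) = 0)" by simp
  moreover have "((if \<not> P y e then 1 else 0 :: nat) = 0) = P y e" for y e by simp
  ultimately show ?thesis by simp
qed

lemma dec_ex_less:
  assumes "dec (\<lambda>z. P (pfst z) (psnd z))" "computable b"
  shows "dec (\<lambda>e. \<exists>y<b e. P y e)"
proof -
  have "computable (\<lambda>e. LEAST y. P y e \<or> y = b e)"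
    by (rule computable_Least)
       (intro dec_disj dec_eq assms computable_pfst computable_id
          computable_comp[OF assms(2)] computable_psnd, blast)
  from dec_less[OF this assms(2)]
  have "dec (\<lambda>e. (LEAST y. P y e \<or> y = b e) < b e)" .
  moreover have "((LEAST y. P y e \<or> y = b e) < b e) = (\<exists>y<b e. P y e)" for e
  proof
    assume *: "(LEAST y. P y e \<or> y = b e) < b e"
    have "P (LEAST y. P y e \<or> y = b e) e \<or> (LEAST y. P y e \<or> y = b e) = b e"
      by (rule LeastI_ex) blast
    with * show "\<exists>y<b e. P y e" by auto
  next
    assume "\<exists>y<b e. P y e"
    then obtain y where y: "y < b e" "P y e" by blast
    have "(LEAST y. P y e \<or> y = b e) \<le> y"
      by (rule Least_le) (simp add: y)
    then show "(LEAST y. P y e \<or> y = b e) < b e" using y by simp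
  qed
  ultimately show ?thesis by simp
qed

lemma computable_power2: "computable f \<Longrightarrow> computable (\<lambda>e. 2 ^ f e)"
proof -
  assume "computable f"
  then have "computable (\<lambda>e. rec_nat 1 (\<lambda>y r. (\<lambda>y r e. 2 * r) y r e) (f e))"
    by (intro computable_rec computable_const computable_mult computable_pfst
        computable_psnd computable_id)
  moreover have "rec_nat 1 (\<lambda>y r. 2 * r) n = (2::nat) ^ n" for n
    by (induction n) auto
  ultimately show ?thesis by simp
qed

lemma computable_div:
  assumes "computable f" "computable g"
  shows "computable (\<lambda>e. f e div g e)"
proof -
  \<comment> \<open>The disjunct \<open>g e = 0\<close> keeps the search total and then yields 0,
    the value of division by zero.\<close>
  have "computable (\<lambda>e. LEAST q. f e < Suc q * g e \<or> g e = 0)"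
  proof (rule computable_Least)
    show "dec (\<lambda>z. f (psnd z) < Suc (pfst z) * g (psnd z) \<or> g (psnd z) = 0)"
      by (intro dec_disj dec_less dec_eq computable_mult computable_Suc computable_const
          computable_pfst computable_comp[OF assms(1)] computable_comp[OF assms(2)]
          computable_psnd computable_id)
    fix e
    have "g e \<noteq> 0 \<Longrightarrow> f e < Suc (f e) * g e" by (cases "g e") auto
    then show "\<exists>q. f e < Suc q * g e \<or> g e = 0" by blast
  qed
  moreover have "(LEAST q. m < Suc q * k \<or> k = 0) = m div k" for m k :: nat
  proof (cases "k = 0")
    case False
    show ?thesis
    proof (rule Least_equality)
      show "m < Suc (m div k) * k \<or> k = 0"
        using False by (metis dividend_less_div_times mult_Suc add.commute neq0_conv)
    next
      fix q assume "m < Suc q * k \<or> k = 0"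
      then have "m div k < Suc q" using False by (simp add: less_mult_imp_div_less)
      then show "m div k \<le> q" by simp
    qed
  qed simp
  ultimately show ?thesis by simp
qed

lemma dec_odd: "computable f \<Longrightarrow> dec (\<lambda>e. odd (f e))"
proof -
  assume "computable f"
  then have "dec (\<lambda>e. f e = Suc (2 * (f e div 2)))"
    by (intro dec_eq computable_Suc computable_mult computable_div computable_const)
  moreover have "(m = Suc (2 * (m div 2))) = odd m" for m :: nat by presburger
  ultimately show ?thesis by simp
qed

section \<open>Quantifiers over coded finite sets and lists\<close>

lemma dec_set_decode:
  "computable f \<Longrightarrow> computable g \<Longrightarrow> dec (\<lambda>e. f e \<in> set_decode (g e))"
  unfolding set_decode_def mem_Collect_eq
  by (intro dec_odd computable_div computable_power2)

text \<open>Bit \<open>i\<close> of \<open>m\<close> is set only if \<open>2 ^ i\<close> is at most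
  \<open>m\<close>. Quantifiers over a coded set thereby become bounded.\<close>

lemma set_decode_less: "i \<in> set_decode m \<Longrightarrow> i < m"
proof -
  assume "i \<in> set_decode m"
  then have "m div 2 ^ i \<noteq> 0" by (auto simp: set_decode_def intro: gr0I)
  then have "2 ^ i \<le> m" by (simp add: div_eq_0_iff)
  then show ?thesis using less_exp[of i] by linarith
qed

lemma dec_bex_set_decode:
  assumes "dec (\<lambda>z. P (pfst z) (psnd z))" "computable m"
  shows "dec (\<lambda>e. \<exists>i\<in>set_decode (m e). P i e)"
proof -
  have "dec (\<lambda>e. \<exists>i<m e. i \<in> set_decode (m e) \<and> P i e)"
    by (intro dec_ex_less dec_conj assms dec_set_decode computable_comp[OF assms(2)]
        computable_pfst computable_psnd computable_id)
  moreover have "(\<exists>i<m e. i \<in> set_decode (m e) \<and> P i e) = (\<exists>i\<in>set_decode (m e). P i e)" for e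
    by (auto dest: set_decode_less)
  ultimately show ?thesis by simp
qed

lemma dec_ball_set_decode:
  assumes "dec (\<lambda>z. P (pfst z) (psnd z))" "computable m"
  shows "dec (\<lambda>e. \<forall>i\<in>set_decode (m e). P i e)"
proof -
  have "dec (\<lambda>e. \<exists>i\<in>set_decode (m e). \<not> P i e)"
    by (rule dec_bex_set_decode[OF dec_not[OF assms(1)] assms(2)])
  from dec_not[OF this] show ?thesis by simp
qed

text \<open>A nonempty list is coded by the successor of the pair of its head and the code of its
  tail. Iterating \<open>psnd (r - 1)\<close> runs through the codes of the successive tails, with 0
  for the empty list; as codes decrease, \<open>n\<close> steps exhaust the list.\<close>

lemma mem_list_decode_iff:
  "a \<in> set (list_decode n) \<longleftrightarrow>
    (\<exists>k<n. rec_nat n (\<lambda>_ r. psnd (r - 1)) k \<noteq> 0 \<and> pfst (rec_nat n (\<lambda>_ r. psnd (r - 1)) k - 1) = a)"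
proof (induction n rule: list_decode.induct)
  case 1
  then show ?case by simp
next
  case (2 n)
  let ?f = "\<lambda>n k. rec_nat n (\<lambda>_ r. psnd (r - 1)) k"
  have shift: "?f (Suc n) (Suc k) = ?f (psnd n) k" for k
    by (induction k) auto
  have le: "psnd n \<le> n"
    using le_prod_encode_2[of "psnd n" "pfst n"] by simp
  \<comment> \<open>Each step lowers a nonzero code by at least one. Hence extending the search from
    \<open>psnd n\<close> to \<open>n\<close> steps finds nothing new.\<close>
  have zero: "k \<ge> m \<Longrightarrow> ?f m k = 0" for m k
  proof -
    have "?f m k \<le> m - k"
    proof (induction k)
      case (Suc k)
      have "psnd (?f m k - 1) \<le> ?f m k - 1"
        using le_prod_encode_2[of "psnd (?f m k - 1)" "pfst (?f m k - 1)"] by simp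
      then show ?case using Suc by simp
    qed simp
    then show "k \<ge> m \<Longrightarrow> ?f m k = 0" by simp
  qed
  have "(\<exists>k<Suc n. ?f (Suc n) k \<noteq> 0 \<and> pfst (?f (Suc n) k - 1) = a)
     \<longleftrightarrow> pfst n = a \<or> (\<exists>k<n. ?f (psnd n) k \<noteq> 0 \<and> pfst (?f (psnd n) k - 1) = a)"
    by (subst Ex_less_Suc2) (simp only: shift, simp)
  also have "(\<exists>k<n. ?f (psnd n) k \<noteq> 0 \<and> pfst (?f (psnd n) k - 1) = a)
     \<longleftrightarrow> (\<exists>k<psnd n. ?f (psnd n) k \<noteq> 0 \<and> pfst (?f (psnd n) k - 1) = a)"
    using le zero by (metis less_le_trans not_le)
  also have "\<dots> \<longleftrightarrow> a \<in> set (list_decode (psnd n))"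
    by (rule "2.IH"[of "pfst n" "psnd n", symmetric]) (simp add: pfst_def psnd_def)
  finally have *: "(\<exists>k<Suc n. ?f (Suc n) k \<noteq> 0 \<and> pfst (?f (Suc n) k - 1) = a)
     \<longleftrightarrow> pfst n = a \<or> a \<in> set (list_decode (psnd n))" .
  have "list_decode (Suc n) = pfst n # list_decode (psnd n)"
    by (simp add: pfst_def psnd_def case_prod_beta)
  then have "a \<in> set (list_decode (Suc n)) \<longleftrightarrow> pfst n = a \<or> a \<in> set (list_decode (psnd n))"
    by auto
  then show ?case by (rule trans[OF _ *[symmetric]])
qed

lemma dec_ball_list_decode:
  assumes "dec (\<lambda>z. P (pfst z) (psnd z))" "computable m"
  shows "dec (\<lambda>e. \<forall>i\<in>set (list_decode (m e)). P i e)"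
proof -
  let ?f = "\<lambda>n k. rec_nat n (\<lambda>_ r. psnd (r - 1)) k"
  have f: "computable (\<lambda>e. ?f (g e) (h e))" if "computable g" "computable h" for g h
  proof -
    have "computable (\<lambda>e. rec_nat (g e) (\<lambda>y r. (\<lambda>y r e. psnd (r - 1)) y r e) (h e))"
      by (intro computable_rec that computable_psnd computable_pfst computable_diff
          computable_const computable_id)
    then show ?thesis by simp
  qed
  have "computable (\<lambda>z. prod_encode (pfst (?f (m (psnd z)) (pfst z) - 1), psnd z))"
    by (intro computable_pair computable_pfst computable_diff f computable_comp[OF assms(2)]
        computable_psnd computable_const computable_id)
  from dec_comp[OF assms(1) this]
  have "dec (\<lambda>z. P (pfst (?f (m (psnd z)) (pfst z) - 1)) (psnd z))"
    by (simp only: pfst_pair psnd_pair)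
  then have "dec (\<lambda>e. \<exists>k<m e. ?f (m e) k \<noteq> 0 \<and> \<not> P (pfst (?f (m e) k - 1)) e)"
    by (intro dec_ex_less dec_conj dec_not dec_eq f computable_comp[OF assms(2)] assms
        computable_psnd computable_pfst computable_const computable_id)
  then have "dec (\<lambda>e. \<not> (\<exists>k<m e. ?f (m e) k \<noteq> 0 \<and> \<not> P (pfst (?f (m e) k - 1)) e))"
    by (rule dec_not)
  moreover have "(\<lambda>e. \<not> (\<exists>k<m e. ?f (m e) k \<noteq> 0 \<and> \<not> P (pfst (?f (m e) k - 1)) e))
     = (\<lambda>e. \<forall>i\<in>set (list_decode (m e)). P i e)"
    unfolding Ball_def mem_list_decode_iff by blast
  ultimately show ?thesis by simp
qed

text \<open>The checks below are formulas over projections, with quantifiers bounded by coded sets,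
  lists or numbers; their decidability follows from their syntactic form.\<close>

lemmas computable_intros =
  computable_const computable_id computable_Suc computable_pfst computable_psnd computable_pair
  computable_power2 computable_if
  dec_const dec_conj dec_disj dec_imp dec_iff dec_not dec_eq dec_set_decode
  dec_ball_set_decode dec_bex_set_decode dec_ball_list_decode dec_ex_less


section \<open>Kripke models\<close>

text \<open>Fitting models for LP: a preorder with an evidence relation persistent along it. The
  carrier is explicit because the syntactic model has all labels as worlds, a finite countermodel
  only the records listed in a coded set.\<close>

locale lp_model =
  fixes CS :: "fm set" and W :: "'w set" and R :: "'w \<Rightarrow> 'w \<Rightarrow> bool"
    and E :: "'w \<Rightarrow> jterm \<Rightarrow> fm \<Rightarrow> bool" and V :: "'w \<Rightarrow> nat \<Rightarrow> bool"
  assumes R_refl: "w \<in> W \<Longrightarrow> R w w"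
    and R_trans: "\<lbrakk>u \<in> W; v \<in> W; w \<in> W; R u v; R v w\<rbrakk> \<Longrightarrow> R u w"
    and E_mono: "\<lbrakk>w \<in> W; v \<in> W; R w v; E w t A\<rbrakk> \<Longrightarrow> E v t A"
    and E_const: "\<lbrakk>w \<in> W; Just (JConst c) A \<in> CS\<rbrakk> \<Longrightarrow> E w (JConst c) A"
    and E_plusL: "\<lbrakk>w \<in> W; E w t A\<rbrakk> \<Longrightarrow> E w (Plus s t) A"
    and E_plusR: "\<lbrakk>w \<in> W; E w t A\<rbrakk> \<Longrightarrow> E w (Plus t s) A"
    and E_app: "\<lbrakk>w \<in> W; E w s (Imp A B); E w t A\<rbrakk> \<Longrightarrow> E w (App s t) B"
    and E_bang: "\<lbrakk>w \<in> W; E w t A\<rbrakk> \<Longrightarrow> E w (Bang t) (Just t A)"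
begin

primrec forces :: "fm \<Rightarrow> 'w \<Rightarrow> bool" where
  "forces (PVar p) w = V w p"
| "forces Bot w = False"
| "forces (Neg A) w = (\<not> forces A w)"
| "forces (And A B) w = (forces A w \<and> forces B w)"
| "forces (Or A B) w = (forces A w \<or> forces B w)"
| "forces (Imp A B) w = (forces A w \<longrightarrow> forces B w)"
| "forces (Just t A) w = (E w t A \<and> (\<forall>v\<in>W. R w v \<longrightarrow> forces A v))"

primrec sat :: "(label \<Rightarrow> 'w) \<Rightarrow> lform \<Rightarrow> bool" where
  "sat g (Forces w A) = forces A (g w)"
| "sat g (Rel w v) = R (g w) (g v)"
| "sat g (Ev w t A) = E (g w) t A"

lemma sat_fun_upd: "v \<notin> labels x \<Longrightarrow> sat (g(v := w)) x = sat g x"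
  by (cases x) auto

theorem soundness:
  assumes "G3LP CS \<Gamma> \<Delta>" "range g \<subseteq> W" "\<forall>x\<in>#\<Gamma>. sat g x"
  shows "\<exists>y\<in>#\<Delta>. sat g y"
  using assms
proof (induction arbitrary: g rule: G3LP.induct)
  case (RJust w v t A \<Gamma> \<Delta>)
  show ?case
  proof (rule ccontr)
    assume no: "\<not> ?case"
    then have "\<not> forces (Just t A) (g w)" by auto
    \<comment> \<open>The antecedent provides the evidence at \<open>g w\<close>, so
      \<open>t:A\<close> can fail only through a successor refuting \<open>A\<close>. The
      eigenvariable \<open>v\<close> is moved there.\<close>
    then obtain u where u: "u \<in> W" "R (g w) u" "\<not> forces A u"
      using RJust.prems by auto
    have fresh: "sat (g(v := u)) x = sat g x"
      if "x \<in># add_mset (Ev w t A) \<Gamma> + add_mset (Forces w (Just t A)) \<Delta>" for x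
      using RJust.hyps(2) that by (intro sat_fun_upd) blast
    have "v \<noteq> w" using RJust.hyps by auto
    have "\<exists>y\<in>#add_mset (Forces v A) \<Delta>. sat (g(v := u)) y"
    proof (rule RJust.IH)
      show "range (g(v := u)) \<subseteq> W" using RJust.prems u by auto
      show "\<forall>x\<in>#add_mset (Rel w v) (add_mset (Ev w t A) \<Gamma>). sat (g(v := u)) x"
        using RJust.prems u fresh \<open>v \<noteq> w\<close> by auto
    qed
    then show False using u no fresh by auto
  qed
next
  case (LJust v A w t \<Gamma> \<Delta>)
  then show ?case by (auto simp: image_subset_iff)
next
  case (Mon v t A w \<Gamma> \<Delta>)
  show ?case using Mon.IH[of g] Mon.prems E_mono[of "g w" "g v" t A] by (auto simp: image_subset_iff)
next
  case (AN w c A \<Gamma> \<Delta>)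
  show ?case using AN.IH[of g] AN.hyps AN.prems E_const[of "g w" c A] by (auto simp: image_subset_iff)
next
  case (Ref w \<Gamma> \<Delta>)
  show ?case using Ref.IH[of g] Ref.prems R_refl[of "g w"] by (auto simp: image_subset_iff)
next
  case (Trans w u v \<Gamma> \<Delta>)
  show ?case using Trans.IH[of g] Trans.prems R_trans[of "g w" "g v" "g u"] by (auto simp: image_subset_iff)
next
  case (EApp w s t B A \<Gamma> \<Delta>)
  show ?case using EApp.IH[of g] EApp.prems E_app[of "g w" s A B t] by (auto simp: image_subset_iff)
next
  case (EBang w t A \<Gamma> \<Delta>)
  show ?case using EBang.IH[of g] EBang.prems E_bang[of "g w" t A] by (auto simp: image_subset_iff)
next
  case (ElPlus w s t A \<Gamma> \<Delta>)
  show ?case using ElPlus.IH[of g] ElPlus.prems E_plusL[of "g w" t A s] by (auto simp: image_subset_iff)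
next
  case (ErPlus w t s A \<Gamma> \<Delta>)
  show ?case using ErPlus.IH[of g] ErPlus.prems E_plusR[of "g w" t A s] by (auto simp: image_subset_iff)
next
  case (LNeg \<Gamma> w A \<Delta>)
  then show ?case by fastforce
next
  case (RNeg w A \<Gamma> \<Delta>)
  then show ?case by fastforce
next
  case (LAnd w A B \<Gamma> \<Delta>)
  then show ?case by fastforce
next
  case (RAnd \<Gamma> w A \<Delta> B)
  then show ?case by fastforce
next
  case (LOr w A \<Gamma> \<Delta> B)
  then show ?case by fastforce
next
  case (ROr \<Gamma> w A B \<Delta>)
  then show ?case by fastforce
next
  case (LImp \<Gamma> w A \<Delta> B)
  then show ?case by fastforce
next
  case (RImp w A \<Gamma> B \<Delta>)
  then show ?case by fastforce
next
  case (E w t A \<Gamma> \<Delta>)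
  then show ?case by fastforce
qed auto

end


section \<open>Completeness\<close>

text \<open>A formula counts as reduced when the active formulas of a premise of its rule are
  present. The clause \<open>False\<close> is for formulas that the search never discards: on the
  left, atoms and also \<open>t:A\<close>, whose rules repeat it in the premise.\<close>

fun reducedL :: "lform \<Rightarrow> lform set \<Rightarrow> lform set \<Rightarrow> bool" where
  "reducedL (Forces w (Neg A)) G D \<longleftrightarrow> Forces w A \<in> D"
| "reducedL (Forces w (And A B)) G D \<longleftrightarrow> Forces w A \<in> G \<and> Forces w B \<in> G"
| "reducedL (Forces w (Or A B)) G D \<longleftrightarrow> Forces w A \<in> G \<or> Forces w B \<in> G"
| "reducedL (Forces w (Imp A B)) G D \<longleftrightarrow> Forces w A \<in> D \<or> Forces w B \<in> G"
| "reducedL _ G D \<longleftrightarrow> False"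

fun reducedR :: "lform \<Rightarrow> lform set \<Rightarrow> lform set \<Rightarrow> bool" where
  "reducedR (Forces w (Neg A)) G D \<longleftrightarrow> Forces w A \<in> G"
| "reducedR (Forces w (And A B)) G D \<longleftrightarrow> Forces w A \<in> D \<or> Forces w B \<in> D"
| "reducedR (Forces w (Or A B)) G D \<longleftrightarrow> Forces w A \<in> D \<and> Forces w B \<in> D"
| "reducedR (Forces w (Imp A B)) G D \<longleftrightarrow> Forces w A \<in> G \<and> Forces w B \<in> D"
| "reducedR (Forces w (Just t A)) G D \<longleftrightarrow> (\<exists>v. Rel w v \<in> G \<and> Forces v A \<in> D)"
| "reducedR _ G D \<longleftrightarrow> False"

fun reducibleL :: "lform \<Rightarrow> bool" where
  "reducibleL (Forces w (Neg A)) = True"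
| "reducibleL (Forces w (And A B)) = True"
| "reducibleL (Forces w (Or A B)) = True"
| "reducibleL (Forces w (Imp A B)) = True"
| "reducibleL _ = False"

text \<open>\<open>RJust\<close> demands evidence on the left. In its absence, a formula
  \<open>t:A\<close> on the right is refuted by the missing evidence instead of by a
  successor.\<close>

fun reducibleR :: "lform \<Rightarrow> lform set \<Rightarrow> bool" where
  "reducibleR (Forces w (Just t A)) G \<longleftrightarrow> Ev w t A \<in> G"
| "reducibleR x G \<longleftrightarrow> reducibleL x"

text \<open>One clause for each rule that merely adds a formula to the antecedent. Closure of
  \<open>G\<close> under \<open>gen\<close> contains all frame and evidence conditions of the limit
  model.\<close>

inductive gen :: "fm set \<Rightarrow> lform set \<Rightarrow> lform \<Rightarrow> bool" for CS G where
  gLJust: "\<lbrakk>Forces w (Just t A) \<in> G; Rel w v \<in> G\<rbrakk> \<Longrightarrow> gen CS G (Forces v A)"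
| gE: "Forces w (Just t A) \<in> G \<Longrightarrow> gen CS G (Ev w t A)"
| gElPlus: "Ev w t A \<in> G \<Longrightarrow> gen CS G (Ev w (Plus s t) A)"
| gErPlus: "Ev w t A \<in> G \<Longrightarrow> gen CS G (Ev w (Plus t s) A)"
| gEApp: "\<lbrakk>Ev w s (Imp A B) \<in> G; Ev w t A \<in> G\<rbrakk> \<Longrightarrow> gen CS G (Ev w (App s t) B)"
| gEBang: "Ev w t A \<in> G \<Longrightarrow> gen CS G (Ev w (Bang t) (Just t A))"
| gMon: "\<lbrakk>Ev w t A \<in> G; Rel w v \<in> G\<rbrakk> \<Longrightarrow> gen CS G (Ev v t A)"
| gAN: "Just (JConst c) A \<in> CS \<Longrightarrow> gen CS G (Ev w (JConst c) A)"
| gRef: "gen CS G (Rel w w)"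
| gTrans: "\<lbrakk>Rel w v \<in> G; Rel v u \<in> G\<rbrakk> \<Longrightarrow> gen CS G (Rel w u)"

text \<open>A rule inspects at most two formulas, so in the union of a chain its application is
  possible at some stage already.\<close>

lemma gen_finite:
  assumes "gen CS G z"
  obtains F where "finite F" "F \<subseteq> G" "gen CS F z"
proof -
  have "\<exists>F. finite F \<and> F \<subseteq> G \<and> gen CS F z"
    using assms
  proof cases
    case (gLJust w t A v)
    then show ?thesis
      by (intro exI[of _ "{Forces w (Just t A), Rel w v}"]) (auto intro: gen.intros)
  next
    case (gEApp w s A B t)
    then show ?thesis
      by (intro exI[of _ "{Ev w s (Imp A B), Ev w t A}"]) (auto intro: gen.intros)
  next
    case (gMon w t A v)
    then show ?thesis
      by (intro exI[of _ "{Ev w t A, Rel w v}"]) (auto intro: gen.intros)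
  next
    case (gTrans w v u)
    then show ?thesis
      by (intro exI[of _ "{Rel w v, Rel v u}"]) (auto intro: gen.intros)
  next
    case (gE w t A)
    then show ?thesis
      by (intro exI[of _ "{Forces w (Just t A)}"]) (auto intro: gen.intros)
  next
    case (gElPlus w t A s)
    then show ?thesis by (intro exI[of _ "{Ev w t A}"]) (auto intro: gen.intros)
  next
    case (gErPlus w t A s)
    then show ?thesis by (intro exI[of _ "{Ev w t A}"]) (auto intro: gen.intros)
  next
    case (gEBang w t A)
    then show ?thesis by (intro exI[of _ "{Ev w t A}"]) (auto intro: gen.intros)
  qed (auto intro!: exI[of _ "{}"] intro: gen.intros)
  then show ?thesis using that by blast
qed

lemma gen_mono: "gen CS F z \<Longrightarrow> F \<subseteq> G \<Longrightarrow> gen CS G z"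
  by (induction rule: gen.induct) (auto intro: gen.intros)

text \<open>No premise of a \<open>gen\<close> clause is reducible, and only reducible formulas
  leave the antecedent. So what the whole history generates, the current antecedent
  generates.\<close>

lemma gen_restrict:
  assumes "gen CS G z" "\<And>x. x \<in> G \<Longrightarrow> \<not> reducibleL x \<Longrightarrow> x \<in> H"
  shows "gen CS H z"
proof -
  have "gen CS (G \<inter> {x. \<not> reducibleL x}) z"
    using assms(1) by (induction rule: gen.induct) (auto intro: gen.intros)
  then show ?thesis by (rule gen_mono) (use assms(2) in blast)
qed

lemma mset_split2:
  assumes "x \<in># M" "y \<in># M" "x \<noteq> y"
  obtains N where "M = add_mset x (add_mset y N)"
proof -
  obtain M' where M': "M = add_mset x M'" using assms(1) by (rule mset_add)
  then have "y \<in># M'" using assms by auto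
  then obtain N where "M' = add_mset y N" by (rule mset_add)
  then show ?thesis using M' that by blast
qed

text \<open>Rules with two principal formulas need two separate occurrences in the multiset. The
  only critical case is \<open>Trans\<close> with both equal to \<open>Rel w w\<close>; then the
  formula to be added is already present, which the second assumption excludes.\<close>

lemma gen_rule:
  assumes "gen CS (set_mset \<Gamma>) z" "z \<notin># \<Gamma>" "G3LP CS (add_mset z \<Gamma>) \<Delta>"
  shows "G3LP CS \<Gamma> \<Delta>"
  using assms(1)
proof cases
  case (gLJust w t A v)
  obtain N where N: "\<Gamma> = add_mset (Forces w (Just t A)) (add_mset (Rel w v) N)"
    by (rule mset_split2[OF gLJust(2,3)]) auto
  show ?thesis using assms(3) unfolding gLJust(1) N by (rule G3LP.LJust)
next
  case (gE w t A)
  obtain N where N: "\<Gamma> = add_mset (Forces w (Just t A)) N"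
    using gE(2) by (rule mset_add)
  show ?thesis using assms(3) unfolding gE(1) N by (rule G3LP.E)
next
  case (gElPlus w t A s)
  obtain N where N: "\<Gamma> = add_mset (Ev w t A) N"
    using gElPlus(2) by (rule mset_add)
  show ?thesis using assms(3) unfolding gElPlus(1) N by (rule G3LP.ElPlus)
next
  case (gErPlus w t A s)
  obtain N where N: "\<Gamma> = add_mset (Ev w t A) N"
    using gErPlus(2) by (rule mset_add)
  show ?thesis using assms(3) unfolding gErPlus(1) N by (rule G3LP.ErPlus)
next
  case (gEApp w s A B t)
  \<comment> \<open>An implication is larger than its antecedent, so the two evidence atoms differ
    even if \<open>s = t\<close>.\<close>
  have "size (Imp A B) \<noteq> size A" by simp
  then have ne: "Ev w s (Imp A B) \<noteq> Ev w t A" by (metis lform.inject(3))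
  obtain N where N: "\<Gamma> = add_mset (Ev w s (Imp A B)) (add_mset (Ev w t A) N)"
    by (rule mset_split2[OF gEApp(2,3) ne])
  show ?thesis using assms(3) unfolding gEApp(1) N by (rule G3LP.EApp)
next
  case (gEBang w t A)
  obtain N where N: "\<Gamma> = add_mset (Ev w t A) N"
    using gEBang(2) by (rule mset_add)
  show ?thesis using assms(3) unfolding gEBang(1) N by (rule G3LP.EBang)
next
  case (gMon w t A v)
  obtain N where N: "\<Gamma> = add_mset (Ev w t A) (add_mset (Rel w v) N)"
    by (rule mset_split2[OF gMon(2,3)]) auto
  show ?thesis using assms(3) unfolding gMon(1) N by (rule G3LP.Mon)
next
  case (gAN c A w)
  show ?thesis using assms(3) gAN(2) unfolding gAN(1) by (rule G3LP.AN)
next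
  case (gRef w)
  show ?thesis using assms(3) unfolding gRef by (rule G3LP.Ref)
next
  case (gTrans w v u)
  then have ne: "Rel w v \<noteq> Rel v u" using assms(2) by auto
  obtain N where N: "\<Gamma> = add_mset (Rel w v) (add_mset (Rel v u) N)"
    by (rule mset_split2[OF gTrans(2,3) ne])
  show ?thesis using assms(3) unfolding gTrans(1) N by (rule G3LP.Trans)
qed

section \<open>Single steps of the search through underivable sequents\<close>

lemma reducedL_mono: "reducedL x G D \<Longrightarrow> G \<subseteq> G' \<Longrightarrow> D \<subseteq> D' \<Longrightarrow> reducedL x G' D'"
  by (induction x G D rule: reducedL.induct) auto

lemma reducedR_mono: "reducedR x G D \<Longrightarrow> G \<subseteq> G' \<Longrightarrow> D \<subseteq> D' \<Longrightarrow> reducedR x G' D'"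
  by (induction x G D rule: reducedR.induct) auto

lemma reducedL_reducibleL: "reducedL x G D \<Longrightarrow> reducibleL x"
  by (induction x G D rule: reducedL.induct) auto

text \<open>The rules of the calculus discard their principal formulas. A state therefore carries, next
  to the current underivable sequent, the sets \<open>G\<close>, \<open>D\<close> of everything that ever occurred in it,
  and a discarded formula has been reduced with respect to \<open>G\<close>, \<open>D\<close>.\<close>

definition search_inv ::
    "fm set \<Rightarrow> lform multiset \<Rightarrow> lform multiset \<Rightarrow> lform set \<Rightarrow> lform set \<Rightarrow> bool" where
  "search_inv CS \<Gamma> \<Delta> G D \<longleftrightarrow> \<not> G3LP CS \<Gamma> \<Delta> \<and> set_mset \<Gamma> \<subseteq> G \<and> set_mset \<Delta> \<subseteq> D \<and>
     (\<forall>x\<in>G. x \<in># \<Gamma> \<or> reducedL x G D) \<and> (\<forall>x\<in>D. x \<in># \<Delta> \<or> reducedR x G D)"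

text \<open>Being reduced persists when the sets grow, so only formulas of the current sequent,
  which might now be discarded, have to be examined.\<close>

lemma search_inv_extend:
  assumes "search_inv CS \<Gamma> \<Delta> G D" "\<not> G3LP CS \<Gamma>' \<Delta>'"
    and "\<And>x. x \<in># \<Gamma> \<Longrightarrow> x \<in># \<Gamma>' \<or> reducedL x (set_mset \<Gamma>') (set_mset \<Delta>')"
    and "\<And>x. x \<in># \<Delta> \<Longrightarrow> x \<in># \<Delta>' \<or> reducedR x (set_mset \<Gamma>') (set_mset \<Delta>')"
  shows "search_inv CS \<Gamma>' \<Delta>' (G \<union> set_mset \<Gamma>') (D \<union> set_mset \<Delta>')"
  using assms reducedL_mono[of _ G D "G \<union> set_mset \<Gamma>'" "D \<union> set_mset \<Delta>'"]
    reducedR_mono[of _ G D "G \<union> set_mset \<Gamma>'" "D \<union> set_mset \<Delta>'"]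
    reducedL_mono[of _ "set_mset \<Gamma>'" "set_mset \<Delta>'" "G \<union> set_mset \<Gamma>'" "D \<union> set_mset \<Delta>'"]
    reducedR_mono[of _ "set_mset \<Gamma>'" "set_mset \<Delta>'" "G \<union> set_mset \<Gamma>'" "D \<union> set_mset \<Delta>'"]
  unfolding search_inv_def by blast

lemma search_gen:
  assumes inv: "search_inv CS \<Gamma> \<Delta> G D" and gen: "gen CS G z"
  shows "\<exists>\<Gamma>' \<Delta>' G' D'. search_inv CS \<Gamma>' \<Delta>' G' D' \<and> G \<subseteq> G' \<and> D \<subseteq> D' \<and> z \<in> G'"
proof (cases "z \<in># \<Gamma>")
  case True
  then show ?thesis using inv unfolding search_inv_def by blast
next
  case False
  have "gen CS (set_mset \<Gamma>) z"
    using gen by (rule gen_restrict) (use inv reducedL_reducibleL in \<open>auto simp: search_inv_def\<close>)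
  then have "\<not> G3LP CS (add_mset z \<Gamma>) \<Delta>"
    using gen_rule False inv unfolding search_inv_def by blast
  from search_inv_extend[OF inv this]
  have "search_inv CS (add_mset z \<Gamma>) \<Delta> (G \<union> set_mset (add_mset z \<Gamma>)) (D \<union> set_mset \<Delta>)"
    by auto
  then show ?thesis
    by (meson Un_upper1 Un_upper2 subsetD union_single_eq_member)
qed

text \<open>An underivable conclusion has an underivable premise; that premise becomes the new
  sequent, and its active formulas reduce \<open>x\<close>.\<close>

lemma reduceL:
  assumes "\<not> G3LP CS (add_mset x \<Gamma>) \<Delta>" "reducibleL x"
  shows "\<exists>\<Gamma>' \<Delta>'. \<not> G3LP CS \<Gamma>' \<Delta>' \<and> set_mset \<Gamma> \<subseteq> set_mset \<Gamma>' \<and>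
    set_mset \<Delta> \<subseteq> set_mset \<Delta>' \<and> reducedL x (set_mset \<Gamma>') (set_mset \<Delta>')"
  using assms(2)
proof (cases x rule: reducibleL.cases)
  case (1 w A)
  with assms(1) have "\<not> G3LP CS \<Gamma> (add_mset (Forces w A) \<Delta>)"
    using G3LP.LNeg[of CS \<Gamma> w A \<Delta>] by auto
  then show ?thesis using 1
    by (intro exI[of _ \<Gamma>] exI[of _ "add_mset (Forces w A) \<Delta>"]) auto
next
  case (2 w A B)
  with assms(1) have "\<not> G3LP CS (add_mset (Forces w A) (add_mset (Forces w B) \<Gamma>)) \<Delta>"
    using G3LP.LAnd[of CS w A B \<Gamma> \<Delta>] by auto
  then show ?thesis using 2
    by (intro exI[of _ "add_mset (Forces w A) (add_mset (Forces w B) \<Gamma>)"] exI[of _ \<Delta>]) auto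
next
  case (3 w A B)
  with assms(1) consider "\<not> G3LP CS (add_mset (Forces w A) \<Gamma>) \<Delta>" | "\<not> G3LP CS (add_mset (Forces w B) \<Gamma>) \<Delta>"
    using G3LP.LOr[of CS w A \<Gamma> \<Delta> B] by auto
  then show ?thesis
  proof cases
    assume "\<not> G3LP CS (add_mset (Forces w A) \<Gamma>) \<Delta>"
    then show ?thesis using 3
      by (intro exI[of _ "add_mset (Forces w A) \<Gamma>"] exI[of _ \<Delta>]) auto
  next
    assume "\<not> G3LP CS (add_mset (Forces w B) \<Gamma>) \<Delta>"
    then show ?thesis using 3
      by (intro exI[of _ "add_mset (Forces w B) \<Gamma>"] exI[of _ \<Delta>]) auto
  qed
next
  case (4 w A B)
  with assms(1) consider "\<not> G3LP CS \<Gamma> (add_mset (Forces w A) \<Delta>)" | "\<not> G3LP CS (add_mset (Forces w B) \<Gamma>) \<Delta>"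
    using G3LP.LImp[of CS \<Gamma> w A \<Delta> B] by auto
  then show ?thesis
  proof cases
    assume "\<not> G3LP CS \<Gamma> (add_mset (Forces w A) \<Delta>)"
    then show ?thesis using 4
      by (intro exI[of _ \<Gamma>] exI[of _ "add_mset (Forces w A) \<Delta>"]) auto
  next
    assume "\<not> G3LP CS (add_mset (Forces w B) \<Gamma>) \<Delta>"
    then show ?thesis using 4
      by (intro exI[of _ "add_mset (Forces w B) \<Gamma>"] exI[of _ \<Delta>]) auto
  qed
qed auto

lemma fresh_label: "\<exists>v. \<forall>x\<in>#M. v \<notin> labels x"
proof -
  have "finite (labels x)" for x by (cases x) auto
  then have "finite (\<Union>x\<in>set_mset M. labels x)" by simp
  then show ?thesis
    using ex_new_if_finite[OF infinite_UNIV_nat] by (metis UN_I)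
qed

lemma reduceR:
  assumes "\<not> G3LP CS \<Gamma> (add_mset x \<Delta>)" "reducibleR x (set_mset \<Gamma>)"
  shows "\<exists>\<Gamma>' \<Delta>'. \<not> G3LP CS \<Gamma>' \<Delta>' \<and> set_mset \<Gamma> \<subseteq> set_mset \<Gamma>' \<and>
    set_mset \<Delta> \<subseteq> set_mset \<Delta>' \<and> reducedR x (set_mset \<Gamma>') (set_mset \<Delta>')"
proof -
  consider w t A where "x = Forces w (Just t A)" | "reducibleL x"
    using assms(2) by (cases "(x, set_mset \<Gamma>)" rule: reducibleR.cases) auto
  then show ?thesis
  proof cases
    case (1 w t A)
    then have "Ev w t A \<in># \<Gamma>" using assms(2) by simp
    then obtain N where N: "\<Gamma> = add_mset (Ev w t A) N" by (rule mset_add)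
    obtain v where "\<forall>x\<in>#add_mset (Ev w t A) N + add_mset (Forces w (Just t A)) \<Delta>. v \<notin> labels x"
      using fresh_label by blast
    then have "\<not> G3LP CS (add_mset (Rel w v) \<Gamma>) (add_mset (Forces v A) \<Delta>)"
      using assms(1) G3LP.RJust[of CS w v t A N \<Delta>] unfolding N 1 by auto
    then show ?thesis using 1
      by (intro exI[of _ "add_mset (Rel w v) \<Gamma>"] exI[of _ "add_mset (Forces v A) \<Delta>"]) auto
  next
    case 2
    then show ?thesis
    proof (cases x rule: reducibleL.cases)
      case (1 w A)
      with assms(1) have "\<not> G3LP CS (add_mset (Forces w A) \<Gamma>) \<Delta>"
        using G3LP.RNeg[of CS w A \<Gamma> \<Delta>] by auto
      then show ?thesis using 1
        by (intro exI[of _ "add_mset (Forces w A) \<Gamma>"] exI[of _ \<Delta>]) auto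
    next
      case (2 w A B)
      with assms(1) consider "\<not> G3LP CS \<Gamma> (add_mset (Forces w A) \<Delta>)" | "\<not> G3LP CS \<Gamma> (add_mset (Forces w B) \<Delta>)"
        using G3LP.RAnd[of CS \<Gamma> w A \<Delta> B] by auto
      then show ?thesis
      proof cases
        assume "\<not> G3LP CS \<Gamma> (add_mset (Forces w A) \<Delta>)"
        then show ?thesis using 2
          by (intro exI[of _ \<Gamma>] exI[of _ "add_mset (Forces w A) \<Delta>"]) auto
      next
        assume "\<not> G3LP CS \<Gamma> (add_mset (Forces w B) \<Delta>)"
        then show ?thesis using 2
          by (intro exI[of _ \<Gamma>] exI[of _ "add_mset (Forces w B) \<Delta>"]) auto
      qed
    next
      case (3 w A B)
      with assms(1) have "\<not> G3LP CS \<Gamma> (add_mset (Forces w A) (add_mset (Forces w B) \<Delta>))"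
        using G3LP.ROr[of CS \<Gamma> w A B \<Delta>] by auto
      then show ?thesis using 3
        by (intro exI[of _ \<Gamma>] exI[of _ "add_mset (Forces w A) (add_mset (Forces w B) \<Delta>)"]) auto
    next
      case (4 w A B)
      with assms(1) have "\<not> G3LP CS (add_mset (Forces w A) \<Gamma>) (add_mset (Forces w B) \<Delta>)"
        using G3LP.RImp[of CS w A \<Gamma> B \<Delta>] by auto
      then show ?thesis using 4
        by (intro exI[of _ "add_mset (Forces w A) \<Gamma>"] exI[of _ "add_mset (Forces w B) \<Delta>"]) auto
    qed auto
  qed
qed

text \<open>By the invariant, a formula of \<open>G\<close> that is not yet reduced is still in the
  current antecedent, where its rule can be applied.\<close>

lemma search_left:
  assumes inv: "search_inv CS \<Gamma> \<Delta> G D" and x: "x \<in> G" "reducibleL x"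
  shows "\<exists>\<Gamma>' \<Delta>' G' D'. search_inv CS \<Gamma>' \<Delta>' G' D' \<and> G \<subseteq> G' \<and> D \<subseteq> D' \<and> reducedL x G' D'"
proof (cases "reducedL x G D")
  case True
  then show ?thesis using inv by blast
next
  case False
  then obtain N where N: "\<Gamma> = add_mset x N"
    using inv x(1) unfolding search_inv_def by (meson mset_add)
  then obtain \<Gamma>' \<Delta>' where *: "\<not> G3LP CS \<Gamma>' \<Delta>'" "set_mset N \<subseteq> set_mset \<Gamma>'" "set_mset \<Delta> \<subseteq> set_mset \<Delta>'"
      "reducedL x (set_mset \<Gamma>') (set_mset \<Delta>')"
    using reduceL[of CS x N \<Delta>] inv x(2) unfolding search_inv_def by blast
  have "search_inv CS \<Gamma>' \<Delta>' (G \<union> set_mset \<Gamma>') (D \<union> set_mset \<Delta>')"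
    by (rule search_inv_extend[OF inv *(1)]) (use * N in auto)
  moreover have "reducedL x (G \<union> set_mset \<Gamma>') (D \<union> set_mset \<Delta>')"
    using *(4) by (rule reducedL_mono) auto
  ultimately show ?thesis by blast
qed

lemma search_right:
  assumes inv: "search_inv CS \<Gamma> \<Delta> G D" and x: "x \<in> D" "reducibleR x G"
  shows "\<exists>\<Gamma>' \<Delta>' G' D'. search_inv CS \<Gamma>' \<Delta>' G' D' \<and> G \<subseteq> G' \<and> D \<subseteq> D' \<and> reducedR x G' D'"
proof (cases "reducedR x G D")
  case True
  then show ?thesis using inv by blast
next
  case False
  then obtain N where N: "\<Delta> = add_mset x N"
    using inv x(1) unfolding search_inv_def by (meson mset_add)
  \<comment> \<open>Evidence atoms are never discarded, so the one that \<open>RJust\<close> demands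
    is still in the current antecedent.\<close>
  have "Ev w t A \<in># \<Gamma>" if "Ev w t A \<in> G" for w t A
    using that inv unfolding search_inv_def by fastforce
  then have "reducibleR x (set_mset \<Gamma>)"
    using x(2) by (cases "(x, G)" rule: reducibleR.cases) auto
  then obtain \<Gamma>' \<Delta>' where *: "\<not> G3LP CS \<Gamma>' \<Delta>'" "set_mset \<Gamma> \<subseteq> set_mset \<Gamma>'" "set_mset N \<subseteq> set_mset \<Delta>'"
      "reducedR x (set_mset \<Gamma>') (set_mset \<Delta>')"
    using reduceR[of CS \<Gamma> x N] inv N unfolding search_inv_def by blast
  have "search_inv CS \<Gamma>' \<Delta>' (G \<union> set_mset \<Gamma>') (D \<union> set_mset \<Delta>')"
    by (rule search_inv_extend[OF inv *(1)]) (use * N in auto)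
  moreover have "reducedR x (G \<union> set_mset \<Gamma>') (D \<union> set_mset \<Delta>')"
    using *(4) by (rule reducedR_mono) auto
  ultimately show ?thesis by blast
qed

lemma reducibleR_mono: "reducibleR x G \<Longrightarrow> G \<subseteq> G' \<Longrightarrow> reducibleR x G'"
  by (induction x G rule: reducibleR.induct) auto

lemma search_step:
  assumes inv: "search_inv CS \<Gamma> \<Delta> G D"
  shows "\<exists>\<Gamma>' \<Delta>' G' D'. search_inv CS \<Gamma>' \<Delta>' G' D' \<and> G \<subseteq> G' \<and> D \<subseteq> D' \<and>
    (gen CS G x \<longrightarrow> x \<in> G') \<and> (x \<in> G \<and> reducibleL x \<longrightarrow> reducedL x G' D') \<and>
    (x \<in> D \<and> reducibleR x G \<longrightarrow> reducedR x G' D')"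
proof -
  obtain \<Gamma>1 \<Delta>1 G1 D1 where 1: "search_inv CS \<Gamma>1 \<Delta>1 G1 D1" "G \<subseteq> G1" "D \<subseteq> D1" "gen CS G x \<longrightarrow> x \<in> G1"
    using search_gen[OF inv] inv by blast
  obtain \<Gamma>2 \<Delta>2 G2 D2 where 2: "search_inv CS \<Gamma>2 \<Delta>2 G2 D2" "G1 \<subseteq> G2" "D1 \<subseteq> D2"
      "x \<in> G \<and> reducibleL x \<longrightarrow> reducedL x G2 D2"
    using search_left[OF 1(1), of x] 1 by blast
  obtain \<Gamma>3 \<Delta>3 G3 D3 where 3: "search_inv CS \<Gamma>3 \<Delta>3 G3 D3" "G2 \<subseteq> G3" "D2 \<subseteq> D3"
      "x \<in> D \<and> reducibleR x G \<longrightarrow> reducedR x G3 D3"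
    using search_right[OF 2(1), of x] 1 2 reducibleR_mono[of x G G2] by blast
  have "reducedL x G2 D2 \<Longrightarrow> reducedL x G3 D3" using 3 by (blast intro: reducedL_mono)
  then have "(x \<in> G \<and> reducibleL x \<longrightarrow> reducedL x G3 D3)" using 2(4) by blast
  with 1 2 3 show ?thesis
    by (intro exI[of _ \<Gamma>3] exI[of _ \<Delta>3] exI[of _ G3] exI[of _ D3]) blast
qed

section \<open>The limit of the search\<close>

instance jterm :: countable by countable_datatype
instance fm :: countable by countable_datatype
instance lform :: countable by countable_datatype

text \<open>Stage \<open>j\<close> treats the formula numbered \<open>pfst j\<close>; varying the
  other component makes every formula recur after any given stage.\<close>

lemma fair_enumeration:
  obtains j where "i \<le> j" "from_nat (pfst j) = (x :: 'a :: countable)"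
  using that[of "prod_encode (to_nat x, i)"] le_prod_encode_2 by simp

fun initial :: "lform \<Rightarrow> bool" where
  "initial (Forces w (PVar p)) = True"
| "initial (Forces w A) = False"
| "initial (Rel w v) = True"
| "initial (Ev w t A) = True"

text \<open>Any demand in the unions already arises at some stage, and the schedule returns to its
  formula later. Initial formulas and \<open>Bot\<close> on the left are never discarded, so a clash
  would make a sequent of the search derivable.\<close>

lemma hintikka_extension:
  assumes "\<not> G3LP CS \<Gamma> \<Delta>"
  obtains G D where
    "set_mset \<Gamma> \<subseteq> G" "set_mset \<Delta> \<subseteq> D"
    "\<And>x. gen CS G x \<Longrightarrow> x \<in> G"
    "\<And>x. x \<in> G \<Longrightarrow> reducibleL x \<Longrightarrow> reducedL x G D"
    "\<And>x. x \<in> D \<Longrightarrow> reducibleR x G \<Longrightarrow> reducedR x G D"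
    "\<And>x. x \<in> G \<Longrightarrow> x \<in> D \<Longrightarrow> \<not> initial x"
    "\<And>w. Forces w Bot \<notin> G"
proof -
  define inv where "inv = (\<lambda>(\<Gamma>, \<Delta>, G, D). search_inv CS \<Gamma> \<Delta> G D)"
  define next_ok where "next_ok x =
    (\<lambda>(\<Gamma> :: lform multiset, \<Delta> :: lform multiset, G, D) (\<Gamma>' :: lform multiset, \<Delta>' :: lform multiset, G', D').
      G \<subseteq> G' \<and> D \<subseteq> D' \<and> (gen CS G x \<longrightarrow> x \<in> G') \<and>
      (x \<in> G \<and> reducibleL x \<longrightarrow> reducedL x G' D') \<and> (x \<in> D \<and> reducibleR x G \<longrightarrow> reducedR x G' D'))"
    for x
  let ?next = "\<lambda>n. next_ok (from_nat (pfst n))"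
  have "search_inv CS \<Gamma> \<Delta> (set_mset \<Gamma>) (set_mset \<Delta>)"
    using assms by (auto simp: search_inv_def)
  then have "\<exists>f. \<forall>n. (inv (f n) \<and> (n = 0 \<longrightarrow> f n = (\<Gamma>, \<Delta>, set_mset \<Gamma>, set_mset \<Delta>)))
      \<and> ?next n (f n) (f (Suc n))"
  proof (intro dependent_nat_choice)
    fix s and n :: nat assume "inv s \<and> (n = 0 \<longrightarrow> s = (\<Gamma>, \<Delta>, set_mset \<Gamma>, set_mset \<Delta>))"
    then have "inv s" by simp
    then obtain \<Gamma>1 \<Delta>1 G1 D1 where s: "s = (\<Gamma>1, \<Delta>1, G1, D1)" "search_inv CS \<Gamma>1 \<Delta>1 G1 D1"
      by (auto simp: inv_def)
    obtain \<Gamma>' \<Delta>' G' D' where "search_inv CS \<Gamma>' \<Delta>' G' D'" "?next n s (\<Gamma>', \<Delta>', G', D')"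
      using search_step[OF s(2), of "from_nat (pfst n)"] unfolding next_ok_def s(1) by auto
    then show "\<exists>s'. (inv s' \<and> (Suc n = 0 \<longrightarrow> s' = (\<Gamma>, \<Delta>, set_mset \<Gamma>, set_mset \<Delta>))) \<and> ?next n s s'"
      by (intro exI[of _ "(\<Gamma>', \<Delta>', G', D')"]) (simp add: inv_def)
  qed (auto simp: inv_def)
  then obtain f where f: "\<And>n. inv (f n)" "f 0 = (\<Gamma>, \<Delta>, set_mset \<Gamma>, set_mset \<Delta>)"
      "\<And>n. ?next n (f n) (f (Suc n))" by blast
  define L R G D where "L = (\<lambda>n. fst (f n))" and "R = (\<lambda>n. fst (snd (f n)))"
    and "G = (\<lambda>n. fst (snd (snd (f n))))" and "D = (\<lambda>n. snd (snd (snd (f n))))"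
  have fn: "f n = (L n, R n, G n, D n)" for n by (simp add: L_def R_def G_def D_def)
  have inv: "search_inv CS (L n) (R n) (G n) (D n)" for n
    using f(1)[of n] by (simp add: inv_def fn)
  have nx: "G n \<subseteq> G (Suc n)" "D n \<subseteq> D (Suc n)"
    "gen CS (G n) (from_nat (pfst n)) \<Longrightarrow> from_nat (pfst n) \<in> G (Suc n)"
    "from_nat (pfst n) \<in> G n \<Longrightarrow> reducibleL (from_nat (pfst n))
       \<Longrightarrow> reducedL (from_nat (pfst n)) (G (Suc n)) (D (Suc n))"
    "from_nat (pfst n) \<in> D n \<Longrightarrow> reducibleR (from_nat (pfst n)) (G n)
       \<Longrightarrow> reducedR (from_nat (pfst n)) (G (Suc n)) (D (Suc n))" for n
    using f(3)[of n] by (auto simp: next_ok_def fn)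
  have G_mono: "m \<le> n \<Longrightarrow> G m \<subseteq> G n" and D_mono: "m \<le> n \<Longrightarrow> D m \<subseteq> D n" for m n
    using lift_Suc_mono_le[of G m n] lift_Suc_mono_le[of D m n] nx(1,2) by auto
  let ?G = "\<Union>n. G n" and ?D = "\<Union>n. D n"
  show thesis
  proof (rule that[of ?G ?D])
    have "G 0 = set_mset \<Gamma>" "D 0 = set_mset \<Delta>" by (simp_all add: G_def D_def f(2))
    then show "set_mset \<Gamma> \<subseteq> ?G" "set_mset \<Delta> \<subseteq> ?D" by blast+
  next
    fix x assume "gen CS ?G x"
    then obtain F where F: "finite F" "F \<subseteq> ?G" "gen CS F x" by (rule gen_finite)
    have "\<exists>i. F \<subseteq> G i"
      using F(1,2)
    proof (induction F)
      case (insert y F)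
      then obtain i j where "F \<subseteq> G i" "y \<in> G j" by auto
      then have "insert y F \<subseteq> G (max i j)"
        using G_mono[of i "max i j"] G_mono[of j "max i j"] by auto
      then show ?case by blast
    qed simp
    then obtain i where i: "F \<subseteq> G i" by blast
    obtain j where j: "i \<le> j" "from_nat (pfst j) = x" by (rule fair_enumeration)
    have "gen CS (G j) x" using F(3) i G_mono[OF j(1)] by (auto intro: gen_mono)
    then show "x \<in> ?G" using nx(3)[of j] j(2) by blast
  next
    fix x assume "x \<in> ?G" and red: "reducibleL x"
    then obtain i where i: "x \<in> G i" by blast
    obtain j where j: "i \<le> j" "from_nat (pfst j) = x" by (rule fair_enumeration)
    then have "reducedL x (G (Suc j)) (D (Suc j))"
      using nx(4)[of j] i G_mono[OF j(1)] red by auto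
    then show "reducedL x ?G ?D" by (rule reducedL_mono) auto
  next
    fix x assume "x \<in> ?D" and red: "reducibleR x ?G"
    then obtain i where i: "x \<in> D i" by blast
    from red obtain k where k: "reducibleR x (G k)"
      by (cases "(x, ?G)" rule: reducibleR.cases) auto
    obtain j where j: "max i k \<le> j" "from_nat (pfst j) = x" by (rule fair_enumeration)
    have "reducibleR x (G j)" using k by (rule reducibleR_mono) (use j G_mono in auto)
    then have "reducedR x (G (Suc j)) (D (Suc j))"
      using nx(5)[of j] i D_mono[of i j] j by auto
    then show "reducedR x ?G ?D" by (rule reducedR_mono) auto
  next
    fix x assume "x \<in> ?G" "x \<in> ?D"
    then obtain i j where "x \<in> G i" "x \<in> D j" by blast
    then have "x \<in> G (max i j)" "x \<in> D (max i j)"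
      using G_mono[of i "max i j"] D_mono[of j "max i j"] by auto
    show "\<not> initial x"
    proof
      assume "initial x"
      then have "\<not> reducedL x (G (max i j)) (D (max i j))" "\<not> reducedR x (G (max i j)) (D (max i j))"
        by (cases x rule: initial.cases; simp)+
      then have "x \<in># L (max i j)" "x \<in># R (max i j)"
        using inv[of "max i j"] \<open>x \<in> G (max i j)\<close> \<open>x \<in> D (max i j)\<close> unfolding search_inv_def by blast+
      then obtain M N where "L (max i j) = add_mset x M" "R (max i j) = add_mset x N"
        by (meson mset_add)
      then have "G3LP CS (L (max i j)) (R (max i j))"
        using \<open>initial x\<close> by (cases x rule: initial.cases) (auto intro: G3LP.intros(1-4))
      then show False using inv[of "max i j"] unfolding search_inv_def by blast
    qed
  next
    fix w
    show "Forces w Bot \<notin> ?G"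
    proof
      assume "Forces w Bot \<in> ?G"
      then obtain i where "Forces w Bot \<in> G i" by blast
      then have "Forces w Bot \<in># L i"
        using inv[of i] reducedL_reducibleL[of "Forces w Bot"] unfolding search_inv_def by fastforce
      then obtain M where "L i = add_mset (Forces w Bot) M" by (rule mset_add)
      then have "G3LP CS (L i) (R i)" by (simp add: G3LP.AxBot)
      then show False using inv[of i] unfolding search_inv_def by blast
    qed
  qed
qed

section \<open>The syntactic model\<close>

theorem completeness:
  assumes "\<not> G3LP CS \<Gamma> \<Delta>"
  obtains R E V where "lp_model CS (UNIV :: nat set) R E"
    "\<And>x. x \<in># \<Gamma> \<Longrightarrow> lp_model.sat UNIV R E V (\<lambda>w. w) x"
    "\<And>x. x \<in># \<Delta> \<Longrightarrow> \<not> lp_model.sat UNIV R E V (\<lambda>w. w) x"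
proof -
  show thesis
    using assms
  proof (rule hintikka_extension)
    fix G D
    assume GD: "set_mset \<Gamma> \<subseteq> G" "set_mset \<Delta> \<subseteq> D"
      and gen: "\<And>x. gen CS G x \<Longrightarrow> x \<in> G"
      and L: "\<And>x. x \<in> G \<Longrightarrow> reducibleL x \<Longrightarrow> reducedL x G D"
      and R: "\<And>x. x \<in> D \<Longrightarrow> reducibleR x G \<Longrightarrow> reducedR x G D"
      and init: "\<And>x. x \<in> G \<Longrightarrow> x \<in> D \<Longrightarrow> \<not> initial x"
      and bot: "\<And>w. Forces w Bot \<notin> G"
    define r e v where defs: "r = (\<lambda>w u. Rel w u \<in> G)" "e = (\<lambda>w t A. Ev w t A \<in> G)"
      "v = (\<lambda>w p. Forces w (PVar p) \<in> G)"
    have r: "r w u \<longleftrightarrow> Rel w u \<in> G" and e: "e w t A \<longleftrightarrow> Ev w t A \<in> G"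
      and v: "v w p \<longleftrightarrow> Forces w (PVar p) \<in> G" for w u t A p
      by (simp_all add: defs)
    interpret lp_model CS UNIV r e v
      by unfold_locales (auto simp: r e intro: gen gen.intros)
    \<comment> \<open>Both sides are treated in one induction because negation and implication
      exchange them.\<close>
    have truth: "(Forces w A \<in> G \<longrightarrow> forces A w) \<and> (Forces w A \<in> D \<longrightarrow> \<not> forces A w)" for w A
    proof (induction A arbitrary: w)
      case (PVar p)
      show ?case using init[of "Forces w (PVar p)"] v[of w p]
        unfolding forces.simps by auto
    next
      case Bot
      show ?case using bot by simp
    next
      case (Neg A)
      then show ?case using L[of "Forces w (Neg A)"] R[of "Forces w (Neg A)"] by auto
    next
      case (And A B)
      then show ?case using L[of "Forces w (And A B)"] R[of "Forces w (And A B)"] by auto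
    next
      case (Or A B)
      then show ?case using L[of "Forces w (Or A B)"] R[of "Forces w (Or A B)"] by auto
    next
      case (Imp A B)
      then show ?case using L[of "Forces w (Imp A B)"] R[of "Forces w (Imp A B)"] by auto
    next
      case (Just t A)
      show ?case
      proof (intro conjI impI)
        assume *: "Forces w (Just t A) \<in> G"
        have "e w t A" using * gen.gE gen e by blast
        moreover have "forces A u" if "r w u" for u
          using * that gen.gLJust[of w t A G u CS] gen r Just.IH by blast
        ultimately show "forces (Just t A) w" unfolding forces.simps by blast
      next
        assume *: "Forces w (Just t A) \<in> D"
        show "\<not> forces (Just t A) w"
        proof
          assume "forces (Just t A) w"
          then have "Ev w t A \<in> G" "\<And>u. r w u \<Longrightarrow> forces A u"
            using e unfolding forces.simps by blast+
          moreover from this(1) obtain u where "Rel w u \<in> G" "Forces u A \<in> D"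
            using R[OF *] by auto
          ultimately show False using r Just.IH by blast
        qed
      qed
    qed
    show thesis
    proof (rule that[of r e v])
      show "lp_model CS (UNIV :: nat set) r e" by (rule lp_model_axioms)
    next
      fix x assume "x \<in># \<Gamma>"
      then show "sat (\<lambda>w. w) x"
        using GD truth r e by (cases x) auto
    next
      fix x assume "x \<in># \<Delta>"
      then show "\<not> sat (\<lambda>w. w) x"
        using GD truth r e init[of x] by (cases x) auto
    qed
  qed
qed


section \<open>Finite countermodels as numbers\<close>

lemma inj_jterm_code: "jterm_code s = jterm_code t \<longleftrightarrow> s = t"
proof (induction s arbitrary: t)
  case (JVar x) show ?case by (cases t) auto
next
  case (JConst x) show ?case by (cases t) auto
next
  case (App s1 s2) then show ?case by (cases t) auto
next
  case (Plus s1 s2) then show ?case by (cases t) auto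
next
  case (Bang s) then show ?case by (cases t) auto
qed

lemma inj_fm_code: "fm_code A = fm_code B \<longleftrightarrow> A = B"
proof (induction A arbitrary: B)
  case (PVar x) show ?case by (cases B) auto
next
  case Bot show ?case by (cases B) auto
next
  case (Neg A) then show ?case by (cases B) auto
next
  case (And A1 A2) then show ?case by (cases B) auto
next
  case (Or A1 A2) then show ?case by (cases B) auto
next
  case (Imp A1 A2) then show ?case by (cases B) auto
next
  case (Just t A) then show ?case by (cases B) (auto simp: inj_jterm_code)
qed

text \<open>Finite sets of codes are represented by numbers through \<^const>\<open>set_decode\<close>. Below, \<open>T\<close> and
  \<open>S\<close> stand for sets of terms and formulas, \<open>V\<close> for a set of pairs (term, formula), \<open>L\<close> for a set
  of labels, \<open>K\<close> for the constant specification and \<open>x\<close> for a sequent.\<close>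

abbreviation fst_arg :: "nat \<Rightarrow> nat" where "fst_arg a \<equiv> pfst (psnd a)"
abbreviation snd_arg :: "nat \<Rightarrow> nat" where "snd_arg a \<equiv> psnd (psnd a)"

section \<open>Closed sets of codes and coded countermodels\<close>

text \<open>The numbers are the constructor tags of \<open>jterm_code\<close>. A finite set meeting
  this local condition is a certificate that its elements are codes.\<close>

definition tm_closed :: "nat \<Rightarrow> bool" where
  "tm_closed T \<longleftrightarrow> (\<forall>t\<in>set_decode T. pfst t = 0 \<or> pfst t = 1 \<or>
     (pfst t = 2 \<or> pfst t = 3) \<and> fst_arg t \<in> set_decode T \<and> snd_arg t \<in> set_decode T \<or>
     pfst t = 4 \<and> psnd t \<in> set_decode T)"

definition fm_closed :: "nat \<Rightarrow> nat \<Rightarrow> bool" where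
  "fm_closed T S \<longleftrightarrow> (\<forall>a\<in>set_decode S. pfst a = 0 \<or> pfst a = 1 \<and> psnd a = 0 \<or>
     pfst a = 2 \<and> psnd a \<in> set_decode S \<or>
     (pfst a = 3 \<or> pfst a = 4 \<or> pfst a = 5) \<and> fst_arg a \<in> set_decode S \<and> snd_arg a \<in> set_decode S \<or>
     pfst a = 6 \<and> fst_arg a \<in> set_decode T \<and> snd_arg a \<in> set_decode S)"

definition entry_ok :: "nat \<Rightarrow> nat \<Rightarrow> nat \<Rightarrow> bool" where
  "entry_ok T S y \<longleftrightarrow> pfst y = 0 \<and> snd_arg y \<in> set_decode S \<or> pfst y = 1 \<or>
     pfst y = 2 \<and> pfst (snd_arg y) \<in> set_decode T \<and> psnd (snd_arg y) \<in> set_decode S"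

definition wellformed :: "nat \<Rightarrow> nat \<Rightarrow> nat \<Rightarrow> bool" where
  "wellformed x T S \<longleftrightarrow> tm_closed T \<and> fm_closed T S \<and>
     (\<forall>y\<in>set (list_decode (pfst x)). entry_ok T S y) \<and>
     (\<forall>y\<in>set (list_decode (psnd x)). entry_ok T S y)"

text \<open>The evidence conditions for target terms in \<open>T\<close>. The code of
  \<open>t:A\<close> is tag 6 with the pair of \<open>t\<close> and \<open>A\<close> as payload,
  that is, with an element of the kind collected in \<open>X\<close>; this explains
  \<open>prod_encode (6, p)\<close> for \<open>!\<close> and \<open>psnd a\<close> for elements of
  \<open>K\<close>.\<close>

definition ev_closed :: "nat \<Rightarrow> nat \<Rightarrow> nat \<Rightarrow> bool" where
  "ev_closed K T X \<longleftrightarrow> (\<forall>a\<in>set_decode K. psnd a \<in> set_decode X) \<and>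
     (\<forall>p\<in>set_decode X. \<forall>t\<in>set_decode T.
       (pfst t = 3 \<and> (fst_arg t = pfst p \<or> snd_arg t = pfst p)
          \<longrightarrow> prod_encode (t, psnd p) \<in> set_decode X) \<and>
       (pfst t = 4 \<and> psnd t = pfst p \<longrightarrow> prod_encode (t, prod_encode (6, p)) \<in> set_decode X) \<and>
       (\<forall>q\<in>set_decode X. pfst t = 2 \<and> fst_arg t = pfst p \<and> snd_arg t = pfst q \<and>
          fst_arg p = 5 \<and> fst_arg (psnd p) = psnd q
          \<longrightarrow> prod_encode (t, snd_arg (psnd p)) \<in> set_decode X))"

abbreviation lab1 :: "nat \<Rightarrow> nat" where "lab1 y \<equiv> fst_arg y"
text \<open>Only relational atoms have a second label; elsewhere it repeats the first, so that one
  formula treats all kinds of atoms.\<close>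

abbreviation lab2 :: "nat \<Rightarrow> nat" where "lab2 y \<equiv> if pfst y = 1 then snd_arg y else fst_arg y"

definition entry_in :: "nat \<Rightarrow> nat \<Rightarrow> nat \<Rightarrow> bool" where
  "entry_in V L y \<longleftrightarrow> lab1 y \<in> set_decode L \<and> lab2 y \<in> set_decode L \<and>
     (pfst y = 2 \<longrightarrow> snd_arg y \<in> set_decode V)"

text \<open>World records are subsets of \<open>S\<close>, \<open>V\<close> and \<open>L\<close>.
  Each \<open>t:A\<close> in \<open>S\<close> has its pair in \<open>V\<close> because the truth of
  \<open>t:A\<close> at a record is tested on that pair.\<close>

definition universe :: "nat \<Rightarrow> nat \<Rightarrow> nat \<Rightarrow> nat \<Rightarrow> nat \<Rightarrow> nat \<Rightarrow> bool" where
  "universe K x T S V L \<longleftrightarrow> wellformed x T S \<and> ev_closed K T V \<and>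
     (\<forall>p\<in>set_decode V. pfst p \<in> set_decode T \<and> psnd p \<in> set_decode S) \<and>
     (\<forall>a\<in>set_decode S. pfst a = 6 \<longrightarrow> psnd a \<in> set_decode V) \<and>
     (\<forall>y\<in>set (list_decode (pfst x)). entry_in V L y) \<and>
     (\<forall>y\<in>set (list_decode (psnd x)). entry_in V L y)"

text \<open>A world records the formulas forced in it, the evidence available in it and the labels of the
  sequent that see it. Accessibility is the coarsest relation under which the last two and the
  forced formulas \<open>t:A\<close> persist, as in the Lemmon filtration.\<close>

abbreviation forced :: "nat \<Rightarrow> nat set" where "forced w \<equiv> set_decode (pfst w)"
abbreviation evidence :: "nat \<Rightarrow> nat set" where "evidence w \<equiv> set_decode (fst_arg w)"
abbreviation below :: "nat \<Rightarrow> nat set" where "below w \<equiv> set_decode (snd_arg w)"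

definition acc :: "nat \<Rightarrow> nat \<Rightarrow> bool" where
  "acc w v \<longleftrightarrow> (\<forall>a\<in>forced w. pfst a = 6 \<longrightarrow> a \<in> forced v) \<and>
     (\<forall>p\<in>evidence w. p \<in> evidence v) \<and> (\<forall>l\<in>below w. l \<in> below v)"

text \<open>The elements of \<open>M\<close> are pairs of a name and a world; the name \<open>Suc o\<close> marks a world as the
  value of the label \<open>o\<close>, and the name \<open>0\<close> is for the other worlds.\<close>

definition locally_ok :: "nat \<Rightarrow> nat \<Rightarrow> nat \<Rightarrow> bool" where
  "locally_ok S M w \<longleftrightarrow> (\<forall>a\<in>set_decode S.
     (pfst a = 1 \<longrightarrow> a \<notin> forced w) \<and>
     (pfst a = 2 \<longrightarrow> (a \<in> forced w \<longleftrightarrow> psnd a \<notin> forced w)) \<and>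
     (pfst a = 3 \<longrightarrow> (a \<in> forced w \<longleftrightarrow> fst_arg a \<in> forced w \<and> snd_arg a \<in> forced w)) \<and>
     (pfst a = 4 \<longrightarrow> (a \<in> forced w \<longleftrightarrow> fst_arg a \<in> forced w \<or> snd_arg a \<in> forced w)) \<and>
     (pfst a = 5 \<longrightarrow> (a \<in> forced w \<longleftrightarrow> (fst_arg a \<in> forced w \<longrightarrow> snd_arg a \<in> forced w))) \<and>
     (pfst a = 6 \<longrightarrow> (a \<in> forced w \<longleftrightarrow> psnd a \<in> evidence w \<and>
        (\<forall>m\<in>set_decode M. acc w (psnd m) \<longrightarrow> snd_arg a \<in> forced (psnd m)))))"

definition holds :: "nat \<Rightarrow> nat \<Rightarrow> nat \<Rightarrow> bool" where
  "holds y w v \<longleftrightarrow> pfst y = 0 \<and> snd_arg y \<in> forced w \<or> pfst y = 1 \<and> acc w v \<or>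
     pfst y = 2 \<and> snd_arg y \<in> evidence w"

text \<open>All elements named by a label are tested, so any of them may interpret it. The condition
  \<open>M \<noteq> 0\<close> provides a world, also as a value for labels outside
  \<open>L\<close>.\<close>

definition countermodel :: "nat \<Rightarrow> nat \<Rightarrow> nat \<Rightarrow> nat \<Rightarrow> nat \<Rightarrow> nat \<Rightarrow> bool" where
  "countermodel K x T S L M \<longleftrightarrow> M \<noteq> 0 \<and>
     (\<forall>l\<in>set_decode L. \<exists>m\<in>set_decode M. pfst m = Suc l) \<and>
     (\<forall>m\<in>set_decode M. locally_ok S M (psnd m) \<and> ev_closed K T (fst_arg (psnd m))) \<and>
     (\<forall>y\<in>set (list_decode (pfst x)). \<forall>m\<in>set_decode M. \<forall>n\<in>set_decode M.
        pfst m = Suc (lab1 y) \<and> pfst n = Suc (lab2 y) \<longrightarrow> holds y (psnd m) (psnd n)) \<and>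
     (\<forall>y\<in>set (list_decode (psnd x)). \<forall>m\<in>set_decode M. \<forall>n\<in>set_decode M.
        pfst m = Suc (lab1 y) \<and> pfst n = Suc (lab2 y) \<longrightarrow> \<not> holds y (psnd m) (psnd n))"

text \<open>The first component of \<open>z\<close> packs \<open>T\<close>, \<open>S\<close>,
  \<open>V\<close>, \<open>L\<close>, the second is the sequent; \<open>dec_countermodel\<close> has
  \<open>M\<close> in front of this pair. Searches vary the first component.\<close>

lemma dec_universe:
  "dec (\<lambda>z. universe K (psnd z) (pfst (pfst z)) (fst_arg (pfst z)) (pfst (snd_arg (pfst z)))
     (psnd (snd_arg (pfst z))))"
  unfolding universe_def wellformed_def tm_closed_def fm_closed_def entry_ok_def ev_closed_def entry_in_def
  by (intro computable_intros)

lemma dec_countermodel: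
  "dec (\<lambda>z. countermodel K (snd_arg z) (pfst (fst_arg z)) (fst_arg (fst_arg z))
     (psnd (snd_arg (fst_arg z))) (pfst z))"
  unfolding countermodel_def locally_ok_def acc_def holds_def ev_closed_def
  by (intro computable_intros)

lemma dec_valid:
  "dec (\<lambda>x. \<exists>T<2 ^ Suc x. \<exists>S<2 ^ Suc x. wellformed x T S)"
  unfolding wellformed_def tm_closed_def fm_closed_def entry_ok_def
  by (intro computable_intros)

section \<open>From certified numbers back to syntax\<close>

lemma pfst_le: "pfst a \<le> a"
  using le_prod_encode_1[of "pfst a" "psnd a"] by simp

lemma psnd_le: "psnd a \<le> a"
  using le_prod_encode_2[of "psnd a" "pfst a"] by simp

text \<open>The code is a triangular number plus the tag, and the payload does not exceed the
  triangular number. All compound constructors have positive tags, so this drives induction on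
  codes.\<close>

lemma psnd_less: "0 < pfst a \<Longrightarrow> psnd a < a"
proof -
  assume "0 < pfst a"
  moreover have "psnd a \<le> triangle (pfst a + psnd a)"
    using le_triangle[of "pfst a + psnd a"] by linarith
  ultimately have "psnd a < prod_encode (pfst a, psnd a)"
    by (simp add: prod_encode_def del: pair_eta)
  then show ?thesis by simp
qed

lemma fst_arg_less: "0 < pfst a \<Longrightarrow> fst_arg a < a"
  using pfst_le[of "psnd a"] psnd_less[of a] by linarith

lemma snd_arg_less: "0 < pfst a \<Longrightarrow> snd_arg a < a"
  using psnd_le[of "psnd a"] psnd_less[of a] by linarith

lemma pair_eqI: "pfst a = k \<Longrightarrow> psnd a = b \<Longrightarrow> a = prod_encode (k, b)"
  by (metis pair_eta)

text \<open>A local closure condition alone would tolerate cycles; they are impossible because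
  components are strictly smaller numbers.\<close>

lemma tm_closed_code:
  assumes "tm_closed T" "t \<in> set_decode T"
  shows "\<exists>s. t = jterm_code s"
  using assms(2)
proof (induction t rule: less_induct)
  case (less t)
  consider "pfst t = 0" | "pfst t = 1"
    | "pfst t = 2 \<or> pfst t = 3" "fst_arg t \<in> set_decode T" "snd_arg t \<in> set_decode T"
    | "pfst t = 4" "psnd t \<in> set_decode T"
    using assms(1)[unfolded tm_closed_def, rule_format, OF less.prems] by argo
  then show ?case
  proof cases
    case 1
    then have "t = jterm_code (JVar (psnd t))" by (simp add: pair_eqI)
    then show ?thesis ..
  next
    case 2
    then have "t = jterm_code (JConst (psnd t))" by (simp add: pair_eqI)
    then show ?thesis ..
  next
    case 3
    then have "0 < pfst t" by auto
    then obtain r s where rs: "fst_arg t = jterm_code r" "snd_arg t = jterm_code s"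
      using less.IH[of "fst_arg t"] less.IH[of "snd_arg t"] 3 fst_arg_less snd_arg_less by blast
    then have "psnd t = prod_encode (jterm_code r, jterm_code s)" by (simp add: pair_eqI)
    then have "t = jterm_code (App r s) \<or> t = jterm_code (Plus r s)"
      using 3(1) by (auto intro: pair_eqI)
    then show ?thesis by blast
  next
    case 4
    then obtain s where "psnd t = jterm_code s"
      using less.IH[of "psnd t"] psnd_less by auto
    then have "t = jterm_code (Bang s)" using 4 by (auto intro: pair_eqI)
    then show ?thesis ..
  qed
qed

lemma fm_closed_code:
  assumes "tm_closed T" "fm_closed T S" "a \<in> set_decode S"
  shows "\<exists>A. a = fm_code A"
  using assms(3)
proof (induction a rule: less_induct)
  case (less a)
  consider "pfst a = 0" | "pfst a = 1" "psnd a = 0"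
    | "pfst a = 2" "psnd a \<in> set_decode S"
    | "pfst a = 3 \<or> pfst a = 4 \<or> pfst a = 5" "fst_arg a \<in> set_decode S" "snd_arg a \<in> set_decode S"
    | "pfst a = 6" "fst_arg a \<in> set_decode T" "snd_arg a \<in> set_decode S"
    using assms(2)[unfolded fm_closed_def, rule_format, OF less.prems] by argo
  then show ?case
  proof cases
    case 1
    then have "a = fm_code (PVar (psnd a))" by (simp add: pair_eqI)
    then show ?thesis ..
  next
    case 2
    then have "a = fm_code Bot" by (simp add: pair_eqI)
    then show ?thesis ..
  next
    case 3
    then obtain A where "psnd a = fm_code A"
      using less.IH[of "psnd a"] psnd_less by auto
    then have "a = fm_code (Neg A)" using 3 by (auto intro: pair_eqI)
    then show ?thesis ..
  next
    case 4
    then have "0 < pfst a" by auto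
    then obtain A B where AB: "fst_arg a = fm_code A" "snd_arg a = fm_code B"
      using less.IH[of "fst_arg a"] less.IH[of "snd_arg a"] 4 fst_arg_less snd_arg_less by blast
    then have "psnd a = prod_encode (fm_code A, fm_code B)" by (simp add: pair_eqI)
    then have "a = fm_code (And A B) \<or> a = fm_code (Or A B) \<or> a = fm_code (Imp A B)"
      using 4(1) by (auto intro: pair_eqI)
    then show ?thesis by blast
  next
    case 5
    then have "0 < pfst a" by auto
    then obtain A where A: "snd_arg a = fm_code A"
      using less.IH[of "snd_arg a"] 5 snd_arg_less by blast
    obtain t where "fst_arg a = jterm_code t" using tm_closed_code[OF assms(1) 5(2)] ..
    with A have "psnd a = prod_encode (jterm_code t, fm_code A)" by (simp add: pair_eqI)
    then have "a = fm_code (Just t A)" using 5(1) by (auto intro: pair_eqI)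
    then show ?thesis ..
  qed
qed

lemma list_decode_sequent_code [simp]:
  "list_decode (pfst (sequent_code (xs, ys))) = map lform_code xs"
  "list_decode (psnd (sequent_code (xs, ys))) = map lform_code ys"
  by (simp_all add: sequent_code_def)

lemma entry_ok_code:
  assumes "tm_closed T" "fm_closed T S" "entry_ok T S y"
  shows "\<exists>z. y = lform_code z"
proof -
  consider "pfst y = 0" "snd_arg y \<in> set_decode S" | "pfst y = 1"
    | "pfst y = 2" "pfst (snd_arg y) \<in> set_decode T" "psnd (snd_arg y) \<in> set_decode S"
    using assms(3) unfolding entry_ok_def by argo
  then show ?thesis
  proof cases
    case 1
    obtain A where "snd_arg y = fm_code A" using fm_closed_code[OF assms(1,2) 1(2)] ..
    then have "psnd y = prod_encode (fst_arg y, fm_code A)" by (simp add: pair_eqI)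
    then have "y = lform_code (Forces (fst_arg y) A)" using 1 by (auto intro: pair_eqI)
    then show ?thesis ..
  next
    case 2
    then have "y = lform_code (Rel (fst_arg y) (snd_arg y))" by (simp add: pair_eqI)
    then show ?thesis ..
  next
    case 3
    obtain A where A: "psnd (snd_arg y) = fm_code A" using fm_closed_code[OF assms(1,2) 3(3)] ..
    obtain t where "pfst (snd_arg y) = jterm_code t" using tm_closed_code[OF assms(1) 3(2)] ..
    with A have "snd_arg y = prod_encode (jterm_code t, fm_code A)" by (simp add: pair_eqI)
    then have "psnd y = prod_encode (fst_arg y, prod_encode (jterm_code t, fm_code A))"
      by (simp add: pair_eqI)
    then have "y = lform_code (Ev (fst_arg y) t A)" using 3 by (auto intro: pair_eqI)
    then show ?thesis ..
  qed
qed

lemma wellformed_code: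
  assumes "wellformed x T S"
  shows "\<exists>s. x = sequent_code s"
proof -
  have *: "\<exists>zs. l = map lform_code zs" if "\<forall>y\<in>set l. entry_ok T S y" for l
    using that
  proof (induction l)
    case (Cons y l)
    have "tm_closed T" "fm_closed T S" using assms unfolding wellformed_def by blast+
    then obtain z where "y = lform_code z"
      using entry_ok_code[of T S y] Cons.prems by auto
    moreover obtain zs where "l = map lform_code zs" using Cons by auto
    ultimately have "y # l = map lform_code (z # zs)" by simp
    then show ?case ..
  qed simp
  obtain xs ys where "list_decode (pfst x) = map lform_code xs" "list_decode (psnd x) = map lform_code ys"
    using *[of "list_decode (pfst x)"] *[of "list_decode (psnd x)"] assms unfolding wellformed_def by blast
  then have "pfst x = list_encode (map lform_code xs)" "psnd x = list_encode (map lform_code ys)"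
    by (metis list_decode_inverse)+
  then have "x = sequent_code (xs, ys)" by (simp add: sequent_code_def pair_eqI)
  then show ?thesis ..
qed

section \<open>Finite countermodels refute derivability\<close>

text \<open>The least evidence relation over the record \<open>X\<close> that serves all terms. Its
  monotonicity in \<open>X\<close> gives persistence along \<open>acc\<close>.\<close>

inductive evid :: "fm set \<Rightarrow> nat set \<Rightarrow> jterm \<Rightarrow> fm \<Rightarrow> bool" for CS X where
  base: "prod_encode (jterm_code t, fm_code A) \<in> X \<Longrightarrow> evid CS X t A"
| const: "Just (JConst c) A \<in> CS \<Longrightarrow> evid CS X (JConst c) A"
| plusL: "evid CS X t A \<Longrightarrow> evid CS X (Plus s t) A"
| plusR: "evid CS X t A \<Longrightarrow> evid CS X (Plus t s) A"
| app: "evid CS X s (Imp A B) \<Longrightarrow> evid CS X t A \<Longrightarrow> evid CS X (App s t) B"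
| bang: "evid CS X t A \<Longrightarrow> evid CS X (Bang t) (Just t A)"

lemma evid_mono: "evid CS X t A \<Longrightarrow> X \<subseteq> Y \<Longrightarrow> evid CS Y t A"
  by (induction rule: evid.induct) (auto intro: evid.intros)

lemma tm_closedD:
  assumes "tm_closed T"
  shows "jterm_code (App s t) \<in> set_decode T \<Longrightarrow> jterm_code s \<in> set_decode T \<and> jterm_code t \<in> set_decode T"
    and "jterm_code (Plus s t) \<in> set_decode T \<Longrightarrow> jterm_code s \<in> set_decode T \<and> jterm_code t \<in> set_decode T"
    and "jterm_code (Bang t) \<in> set_decode T \<Longrightarrow> jterm_code t \<in> set_decode T"
  using assms unfolding tm_closed_def by force+

lemma ev_closedD:
  assumes "ev_closed K T X"
  shows "a \<in> set_decode K \<Longrightarrow> psnd a \<in> set_decode X"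
    and "prod_encode (r, b) \<in> set_decode X \<Longrightarrow> prod_encode (3, prod_encode (s, r)) \<in> set_decode T \<Longrightarrow>
      prod_encode (prod_encode (3, prod_encode (s, r)), b) \<in> set_decode X"
    and "prod_encode (r, b) \<in> set_decode X \<Longrightarrow> prod_encode (3, prod_encode (r, s)) \<in> set_decode T \<Longrightarrow>
      prod_encode (prod_encode (3, prod_encode (r, s)), b) \<in> set_decode X"
    and "prod_encode (r, b) \<in> set_decode X \<Longrightarrow> prod_encode (4, r) \<in> set_decode T \<Longrightarrow>
      prod_encode (prod_encode (4, r), prod_encode (6, prod_encode (r, b))) \<in> set_decode X"
    and "prod_encode (r, prod_encode (5, prod_encode (b, c))) \<in> set_decode X \<Longrightarrow>
      prod_encode (s, b) \<in> set_decode X \<Longrightarrow> prod_encode (2, prod_encode (r, s)) \<in> set_decode T \<Longrightarrow>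
      prod_encode (prod_encode (2, prod_encode (r, s)), c) \<in> set_decode X"
  using assms unfolding ev_closed_def by (blast, force, force, force, force)

text \<open>Conservativity on \<open>T\<close>: constants are covered by \<open>K\<close>, and
  subterms of a term in \<open>T\<close> are again in \<open>T\<close>, so the induction hypotheses
  apply to the premises.\<close>

lemma evid_code:
  assumes "evid CS (set_decode X) t A" "jterm_code t \<in> set_decode T"
    and "tm_closed T" "ev_closed (set_encode (fm_code ` CS)) T X" "finite CS"
  shows "prod_encode (jterm_code t, fm_code A) \<in> set_decode X"
  using assms(1,2)
proof (induction rule: evid.induct)
  case (const c A)
  then have "fm_code (Just (JConst c) A) \<in> set_decode (set_encode (fm_code ` CS))"
    using assms(5) by (simp del: fm_code.simps)
  from ev_closedD(1)[OF assms(4) this] show ?case by simp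
next
  case (plusL t A s)
  then show ?case using tm_closedD(2)[OF assms(3)] ev_closedD(2)[OF assms(4)] by simp
next
  case (plusR t A s)
  then show ?case using tm_closedD(2)[OF assms(3)] ev_closedD(3)[OF assms(4)] by simp
next
  case (app s A B t)
  then show ?case
    using tm_closedD(1)[OF assms(3) app.prems]
      ev_closedD(5)[OF assms(4), of "jterm_code s" "fm_code A" "fm_code B" "jterm_code t"] by simp
next
  case (bang t A)
  then show ?case using tm_closedD(3)[OF assms(3)] ev_closedD(4)[OF assms(4)] by simp
qed

lemma countermodel_underivable:
  assumes CS: "finite CS" and K: "K = set_encode (fm_code ` CS)" and x: "x = sequent_code (xs, ys)"
    and U: "universe K x T S V L" and M: "countermodel K x T S L M"
  shows "\<not> G3LP CS (mset xs) (mset ys)"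
proof
  assume der: "G3LP CS (mset xs) (mset ys)"
  define W where "W = psnd ` set_decode M"
  define E where "E = (\<lambda>w. evid CS (evidence w))"
  define Vl where "Vl = (\<lambda>w p. fm_code (PVar p) \<in> forced w)"
  have T: "tm_closed T" and S: "fm_closed T S"
    using U unfolding universe_def wellformed_def by blast+
  interpret lp_model CS W acc E Vl
  proof
    show "acc w w" for w by (simp add: acc_def)
    show "acc u v \<Longrightarrow> acc v w \<Longrightarrow> acc u w" for u v w by (auto simp: acc_def)
    show "acc w v \<Longrightarrow> E w t A \<Longrightarrow> E v t A" for w v t A
      unfolding E_def acc_def by (auto intro: evid_mono)
  qed (auto simp: E_def intro: evid.intros)
  have W: "locally_ok S M w" "ev_closed K T (fst_arg w)" if "w \<in> W" for w
    using M that unfolding countermodel_def W_def by blast+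
  have W_all: "(\<forall>v\<in>W. P v) \<longleftrightarrow> (\<forall>m\<in>set_decode M. P (psnd m))" for P
    by (simp add: W_def)
  have ev: "E w t A \<longleftrightarrow> prod_encode (jterm_code t, fm_code A) \<in> evidence w"
    if "w \<in> W" "jterm_code t \<in> set_decode T" for w t A
    using evid_code[OF _ that(2) T _ CS] W(2)[OF that(1)] K by (auto simp: E_def intro: evid.base)
  have truth: "fm_code A \<in> set_decode S \<Longrightarrow> w \<in> W \<Longrightarrow> forces A w \<longleftrightarrow> fm_code A \<in> forced w" for A w
  proof (induction A arbitrary: w)
    case (PVar p)
    show ?case unfolding forces.simps unfolding Vl_def ..
  next
    case Bot
    then show ?case using W(1)[of w] by (force simp: locally_ok_def)
  next
    case (Neg A)
    have "fm_code A \<in> set_decode S" using S Neg.prems(1) by (force simp: fm_closed_def)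
    then show ?case using Neg W(1)[of w] by (force simp: locally_ok_def)
  next
    case (And A B)
    have "fm_code A \<in> set_decode S" "fm_code B \<in> set_decode S"
      using S And.prems(1) by (force simp: fm_closed_def)+
    then show ?case using And W(1)[of w] by (force simp: locally_ok_def)
  next
    case (Or A B)
    have "fm_code A \<in> set_decode S" "fm_code B \<in> set_decode S"
      using S Or.prems(1) by (force simp: fm_closed_def)+
    then show ?case using Or W(1)[of w] by (force simp: locally_ok_def)
  next
    case (Imp A B)
    have "fm_code A \<in> set_decode S" "fm_code B \<in> set_decode S"
      using S Imp.prems(1) by (force simp: fm_closed_def)+
    then show ?case using Imp W(1)[of w] by (force simp: locally_ok_def)
  next
    case (Just t A)
    have sub: "fm_code A \<in> set_decode S" "jterm_code t \<in> set_decode T"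
      using S Just.prems(1) by (force simp: fm_closed_def)+
    have "fm_code (Just t A) \<in> forced w \<longleftrightarrow> prod_encode (jterm_code t, fm_code A) \<in> evidence w \<and>
        (\<forall>v\<in>W. acc w v \<longrightarrow> fm_code A \<in> forced v)"
      using W(1)[OF Just.prems(2)] Just.prems(1) unfolding W_all locally_ok_def by force
    then show ?case using ev[OF Just.prems(2) sub(2)] Just.IH[OF sub(1)] by simp
  qed
  have "M \<noteq> 0" using M unfolding countermodel_def by blast
  then have "set_decode M \<noteq> {}" using set_decode_inverse[of M] by (metis set_encode_empty)
  then obtain w0 where w0: "w0 \<in> W" by (auto simp: W_def)
  \<comment> \<open>Labels outside \<open>L\<close> do not occur in the sequent but must be given
    some world.\<close>
  have "\<exists>m. m \<in> set_decode M \<and> (l \<in> set_decode L \<longrightarrow> pfst m = Suc l)" for l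
    using M w0 unfolding countermodel_def W_def by blast
  then obtain h where h: "\<And>l. h l \<in> set_decode M" "\<And>l. l \<in> set_decode L \<Longrightarrow> pfst (h l) = Suc l"
    by metis
  define g where "g l = psnd (h l)" for l
  have gW: "g l \<in> W" for l using h(1) by (simp add: g_def W_def)
  have sat_iff: "sat g y \<longleftrightarrow> holds (lform_code y) (g (lab1 (lform_code y))) (g (lab2 (lform_code y)))"
    if "entry_ok T S (lform_code y)" for y
    using that truth gW ev by (cases y) (auto simp: entry_ok_def holds_def)
  have ok: "entry_ok T S (lform_code y)" "entry_in V L (lform_code y)" if "y \<in> set xs \<union> set ys" for y
    using U that unfolding universe_def wellformed_def x by auto
  have names: "pfst (h (lab1 (lform_code y))) = Suc (lab1 (lform_code y))"
    "pfst (h (lab2 (lform_code y))) = Suc (lab2 (lform_code y))" if "y \<in> set xs \<union> set ys" for y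
    using h(2) ok(2)[OF that] unfolding entry_in_def by blast+
  have "\<forall>y\<in>#mset xs. sat g y"
  proof
    fix y assume y: "y \<in># mset xs"
    then have "holds (lform_code y) (psnd (h (lab1 (lform_code y)))) (psnd (h (lab2 (lform_code y))))"
      using M names[of y] h(1) unfolding countermodel_def x list_decode_sequent_code by simp
    then show "sat g y" using sat_iff[OF ok(1)] y by (simp add: g_def)
  qed
  moreover have "\<not> sat g y" if y: "y \<in># mset ys" for y
  proof -
    have "\<not> holds (lform_code y) (psnd (h (lab1 (lform_code y)))) (psnd (h (lab2 (lform_code y))))"
      using M names[of y] h(1) y unfolding countermodel_def x list_decode_sequent_code by simp
    then show ?thesis using sat_iff[OF ok(1)] y by (simp add: g_def)
  qed
  ultimately show False using soundness[OF der, of g] gW by blast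
qed

section \<open>Filtration of the syntactic model\<close>

lemma prod_encode_mono:
  assumes "a \<le> c" "b \<le> d"
  shows "prod_encode (a, b) \<le> prod_encode (c, d)"
  using assms mono_triangle[of "a + b" "c + d"] by (simp add: prod_encode_def)

lemma set_encode_less: "A \<subseteq> {..n} \<Longrightarrow> set_encode A < 2 ^ Suc n"
proof -
  assume "A \<subseteq> {..n}"
  then have "set_encode A \<le> sum ((^) 2) {..n}"
    unfolding set_encode_def by (intro sum_mono2) auto
  also have "\<dots> < 2 ^ Suc n" by (induction n) auto
  finally show ?thesis .
qed

text \<open>Subsets of the sets coded by \<open>S\<close>, \<open>V\<close>, \<open>L\<close> have
  codes at most \<open>S\<close>, \<open>V\<close>, \<open>L\<close>, and a name
  \<open>Suc l\<close> is at most \<open>L\<close> since members of \<open>set_decode L\<close> lie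
  below \<open>L\<close>. The inner number thus bounds every element of \<open>M\<close>.\<close>

definition bound :: "nat \<Rightarrow> nat \<Rightarrow> nat \<Rightarrow> nat" where
  "bound S V L = 2 ^ Suc (prod_encode (L, prod_encode (S, prod_encode (V, L))))"

text \<open>Passing to records must preserve \<open>R\<close>, so that refuting worlds stay
  accessible, and must create no accessibility from labels in \<open>L\<close>, so that relational
  atoms on the right stay false. \<open>R_acc\<close> and \<open>acc_R\<close> are these two
  facts.\<close>

lemma underivable_countermodel:
  assumes CS: "finite CS" "constant_specification CS" and K: "K = set_encode (fm_code ` CS)"
    and x: "x = sequent_code (xs, ys)"
    and U: "universe K x T S V L" and nd: "\<not> G3LP CS (mset xs) (mset ys)"
  shows "\<exists>M<bound S V L. countermodel K x T S L M"
proof -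
  obtain R E Vl where model: "lp_model CS (UNIV :: nat set) R E"
    and pos: "\<And>x. x \<in># mset xs \<Longrightarrow> lp_model.sat UNIV R E Vl (\<lambda>w. w) x"
    and neg: "\<And>x. x \<in># mset ys \<Longrightarrow> \<not> lp_model.sat UNIV R E Vl (\<lambda>w. w) x"
    using completeness[OF nd] by blast
  interpret lp_model CS "UNIV :: nat set" R E Vl by (rule model)
  have T: "tm_closed T" and S: "fm_closed T S" and VT: "ev_closed K T V"
    and SV: "\<And>a. a \<in> set_decode S \<Longrightarrow> pfst a = 6 \<Longrightarrow> psnd a \<in> set_decode V"
    and VS: "\<And>p. p \<in> set_decode V \<Longrightarrow> pfst p \<in> set_decode T \<and> psnd p \<in> set_decode S"
    using U unfolding universe_def wellformed_def by blast+
  have ok: "entry_ok T S (lform_code y)" "entry_in V L (lform_code y)" if "y \<in> set xs \<union> set ys" for y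
    using U that unfolding universe_def wellformed_def x by auto
  define fo where "fo = (\<lambda>w. {a \<in> set_decode S. \<exists>A. a = fm_code A \<and> forces A w})"
  define ev where "ev = (\<lambda>w. {p \<in> set_decode V. \<exists>t A. p = prod_encode (jterm_code t, fm_code A) \<and> E w t A})"
  define be where "be = (\<lambda>w. {l \<in> set_decode L. R l w})"
  define wc where "wc = (\<lambda>w. prod_encode (set_encode (fo w),
    prod_encode (set_encode (ev w), set_encode (be w))))"
  have fin: "finite (fo w)" "finite (ev w)" "finite (be w)" for w
    by (auto simp: fo_def ev_def be_def)
  have wc: "forced (wc w) = fo w" "evidence (wc w) = ev w" "below (wc w) = be w" for w
    by (simp_all add: wc_def fin)
  have fo: "fm_code A \<in> fo w \<longleftrightarrow> fm_code A \<in> set_decode S \<and> forces A w" for A w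
    by (auto simp: fo_def inj_fm_code)
  have ev: "prod_encode (jterm_code t, fm_code A) \<in> ev w \<longleftrightarrow>
      prod_encode (jterm_code t, fm_code A) \<in> set_decode V \<and> E w t A" for t A w
    by (auto simp: ev_def inj_fm_code inj_jterm_code)
  have V_code: "\<exists>t A. p = prod_encode (jterm_code t, fm_code A)" if "p \<in> set_decode V" for p
    using VS[OF that] tm_closed_code[OF T] fm_closed_code[OF T S] pair_eqI by metis
  \<comment> \<open>Every record appears under the name 0, and the value of a label \<open>l\<close>
    in \<open>L\<close> once more under \<open>Suc l\<close>. Infinitely many worlds share finitely
    many records.\<close>
  define N where "N = (\<lambda>w. prod_encode (0, wc w)) ` UNIV \<union> (\<lambda>l. prod_encode (Suc l, wc l)) ` set_decode L"
  define M where "M = set_encode N"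
  have N_bound: "N \<subseteq> {..prod_encode (L, prod_encode (S, prod_encode (V, L)))}"
  proof -
    have "set_encode X \<le> m" if "X \<subseteq> set_decode m" for X m
      using subset_decode_imp_le[of "set_encode X" m] that finite_subset[OF that] by simp
    then have "wc w \<le> prod_encode (S, prod_encode (V, L))" for w
      unfolding wc_def by (intro prod_encode_mono) (auto simp: fo_def ev_def be_def)
    then show ?thesis
      by (auto simp: N_def intro!: prod_encode_mono dest: set_decode_less)
  qed
  then have decM: "set_decode M = N"
    unfolding M_def using finite_subset[OF N_bound] by simp
  have acc_iff: "acc (wc w) (wc v) \<longleftrightarrow> (\<forall>t A. fm_code (Just t A) \<in> fo w \<longrightarrow> fm_code (Just t A) \<in> fo v) \<and>
      ev w \<subseteq> ev v \<and> be w \<subseteq> be v" for w v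
  proof -
    have "\<exists>t A. a = fm_code (Just t A)" if "a \<in> fo w" "pfst a = 6" for a
    proof -
      obtain A where "a = fm_code A" using \<open>a \<in> fo w\<close> by (auto simp: fo_def)
      then show ?thesis using \<open>pfst a = 6\<close> by (cases A) (auto simp: inj_fm_code inj_jterm_code)
    qed
    then have "(\<forall>a\<in>fo w. pfst a = 6 \<longrightarrow> a \<in> fo v) \<longleftrightarrow>
        (\<forall>t A. fm_code (Just t A) \<in> fo w \<longrightarrow> fm_code (Just t A) \<in> fo v)"
      by (metis fm_code.simps(7) pfst_pair)
    then show ?thesis unfolding acc_def wc by blast
  qed
  have R_acc: "acc (wc w) (wc v)" if "R w v" for w v
    unfolding acc_iff
  proof (intro conjI allI impI)
    fix t A assume "fm_code (Just t A) \<in> fo w"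
    then have *: "fm_code (Just t A) \<in> set_decode S" "forces (Just t A) w"
      unfolding fo by blast+
    \<comment> \<open>\<open>t:A\<close> persists along \<open>R\<close>: its evidence by
      \<open>E_mono\<close>, its condition on successors by transitivity.\<close>
    then have "forces (Just t A) v"
      using that E_mono[of w v t A] R_trans[of w v] by auto
    with * show "fm_code (Just t A) \<in> fo v" unfolding fo by blast
  next
    show "ev w \<subseteq> ev v" using that E_mono[of w v] by (auto simp: ev_def)
    show "be w \<subseteq> be v" using that R_trans[of _ w v] by (auto simp: be_def)
  qed
  \<comment> \<open>Reflexivity puts \<open>l\<close> into \<open>be l\<close>; its persistence into
    \<open>be w\<close> is exactly \<open>R l w\<close>.\<close>
  have acc_R: "R l w" if "l \<in> set_decode L" "acc (wc l) (wc w)" for l w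
    using that R_refl[of l] unfolding acc_iff by (auto simp: be_def)
  have psnd_N: "psnd ` N = range wc" by (force simp: N_def)
  have N_all: "(\<forall>m\<in>N. acc u (psnd m) \<longrightarrow> b \<in> forced (psnd m)) \<longleftrightarrow>
      (\<forall>v. acc u (wc v) \<longrightarrow> b \<in> fo v)" for u b
    using psnd_N wc(1) by (metis (no_types, lifting) image_iff rangeI UNIV_I)
  have S_code: "\<exists>A. a = fm_code A" if "a \<in> set_decode S" for a
    using fm_closed_code[OF T S that] .
  have local: "locally_ok S M (wc w)" for w
    unfolding locally_ok_def decM N_all wc
  proof (intro ballI)
    fix a assume a: "a \<in> set_decode S"
    then obtain A where A: "a = fm_code A" using S_code by blast
    let ?P = "\<lambda>a. (pfst a = 1 \<longrightarrow> a \<notin> fo w) \<and>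
     (pfst a = 2 \<longrightarrow> (a \<in> fo w \<longleftrightarrow> psnd a \<notin> fo w)) \<and>
     (pfst a = 3 \<longrightarrow> (a \<in> fo w \<longleftrightarrow> fst_arg a \<in> fo w \<and> snd_arg a \<in> fo w)) \<and>
     (pfst a = 4 \<longrightarrow> (a \<in> fo w \<longleftrightarrow> fst_arg a \<in> fo w \<or> snd_arg a \<in> fo w)) \<and>
     (pfst a = 5 \<longrightarrow> (a \<in> fo w \<longleftrightarrow> (fst_arg a \<in> fo w \<longrightarrow> snd_arg a \<in> fo w))) \<and>
     (pfst a = 6 \<longrightarrow> (a \<in> fo w \<longleftrightarrow> psnd a \<in> ev w \<and>
        (\<forall>v. acc (wc w) (wc v) \<longrightarrow> snd_arg a \<in> fo v)))"
    show "?P a"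
    proof (cases A)
      case (PVar p)
      then show ?thesis by (simp add: A)
    next
      case Bot
      then show ?thesis using fo[of Bot] by (simp add: A)
    next
      case (Neg B)
      moreover have "fm_code B \<in> set_decode S" using S a by (force simp: fm_closed_def A Neg)
      ultimately show ?thesis using fo[of "Neg B"] fo[of B] a by (simp add: A)
    next
      case (And B C)
      moreover have "fm_code B \<in> set_decode S" "fm_code C \<in> set_decode S"
        using S a by (force simp: fm_closed_def A And)+
      ultimately show ?thesis using fo[of "And B C"] fo[of B] fo[of C] a by (simp add: A)
    next
      case (Or B C)
      moreover have "fm_code B \<in> set_decode S" "fm_code C \<in> set_decode S"
        using S a by (force simp: fm_closed_def A Or)+
      ultimately show ?thesis using fo[of "Or B C"] fo[of B] fo[of C] a by (simp add: A)
    next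
      case (Imp B C)
      moreover have "fm_code B \<in> set_decode S" "fm_code C \<in> set_decode S"
        using S a by (force simp: fm_closed_def A Imp)+
      ultimately show ?thesis using fo[of "Imp B C"] fo[of B] fo[of C] a by (simp add: A)
    next
      case (Just t B)
      have B: "fm_code B \<in> set_decode S" using S a by (force simp: fm_closed_def A Just)
      have tB: "prod_encode (jterm_code t, fm_code B) \<in> set_decode V"
        using SV[OF a] by (simp add: A Just)
      have "fm_code (Just t B) \<in> fo w \<longleftrightarrow> prod_encode (jterm_code t, fm_code B) \<in> ev w \<and>
          (\<forall>v. acc (wc w) (wc v) \<longrightarrow> fm_code B \<in> fo v)"
      proof
        assume *: "fm_code (Just t B) \<in> fo w"
        then have "E w t B" unfolding fo by simp
        moreover have "fm_code B \<in> fo v" if "acc (wc w) (wc v)" for v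
        proof -
          \<comment> \<open>Accessibility carries over \<open>t:B\<close> itself, and reflexivity at
            \<open>v\<close> then yields \<open>B\<close>.\<close>
          have "forces (Just t B) v" using that * unfolding acc_iff fo by blast
          then have "forces B v" using R_refl[of v] by simp
          with B show ?thesis unfolding fo by blast
        qed
        ultimately show "prod_encode (jterm_code t, fm_code B) \<in> ev w \<and>
          (\<forall>v. acc (wc w) (wc v) \<longrightarrow> fm_code B \<in> fo v)" using tB unfolding ev by blast
      next
        assume "prod_encode (jterm_code t, fm_code B) \<in> ev w \<and>
          (\<forall>v. acc (wc w) (wc v) \<longrightarrow> fm_code B \<in> fo v)"
        then have "E w t B" "\<And>v. R w v \<Longrightarrow> forces B v"
          using R_acc unfolding ev fo by blast+
        then have "forces (Just t B) w" by simp
        then show "fm_code (Just t B) \<in> fo w" using a unfolding fo A Just by blast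
      qed
      then show ?thesis by (simp add: A Just)
    qed
  qed
  \<comment> \<open>The record is the part of \<open>E w\<close> inside \<open>V\<close>, and both
    are closed under the evidence rules for targets in \<open>T\<close>.\<close>
  have ev_closed: "ev_closed K T (fst_arg (wc w))" for w
    unfolding ev_closed_def wc
  proof (intro conjI ballI impI)
    fix a assume a: "a \<in> set_decode K"
    then obtain F where F: "F \<in> CS" "a = fm_code F" using CS(1) K by auto
    then obtain c A where cA: "F = Just (JConst c) A"
      using CS(2) unfolding constant_specification_def by blast
    have "psnd a \<in> set_decode V" using VT a by (rule ev_closedD)
    then show "psnd a \<in> ev w"
      using ev[of "JConst c" A w] E_const[of w c A] F cA by simp
  next
    fix p t assume p: "p \<in> ev w" and t: "t \<in> set_decode T"
      and *: "pfst t = 3 \<and> (fst_arg t = pfst p \<or> snd_arg t = pfst p)"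
    obtain r A where rA: "p = prod_encode (jterm_code r, fm_code A)" "E w r A" "p \<in> set_decode V"
      using p by (auto simp: ev_def)
    obtain t' where t': "t = jterm_code t'" using tm_closed_code[OF T t] ..
    have "prod_encode (t, psnd p) \<in> set_decode V"
      using VT rA(3) t * unfolding ev_closed_def by blast
    moreover have "E w t' A"
      using * rA(2) E_plusL[of w r A] E_plusR[of w r A]
      by (cases t') (auto simp: t' rA(1) inj_jterm_code)
    ultimately show "prod_encode (t, psnd p) \<in> ev w" using ev[of t' A] by (simp add: t' rA(1))
  next
    fix p t assume p: "p \<in> ev w" and t: "t \<in> set_decode T" and *: "pfst t = 4 \<and> psnd t = pfst p"
    obtain r A where rA: "p = prod_encode (jterm_code r, fm_code A)" "E w r A" "p \<in> set_decode V"
      using p by (auto simp: ev_def)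
    have t': "t = jterm_code (Bang r)" using * by (simp add: pair_eqI rA(1))
    have "prod_encode (t, prod_encode (6, p)) \<in> set_decode V"
      using VT rA(3) t * unfolding ev_closed_def by blast
    then show "prod_encode (t, prod_encode (6, p)) \<in> ev w"
      using ev[of "Bang r" "Just r A"] E_bang[of w r A] rA(2) by (simp add: t' rA(1))
  next
    fix p t q assume p: "p \<in> ev w" and t: "t \<in> set_decode T" and q: "q \<in> ev w"
      and *: "pfst t = 2 \<and> fst_arg t = pfst p \<and> snd_arg t = pfst q \<and>
          fst_arg p = 5 \<and> fst_arg (psnd p) = psnd q"
    obtain r A where rA: "p = prod_encode (jterm_code r, fm_code A)" "E w r A" "p \<in> set_decode V"
      using p by (auto simp: ev_def)
    obtain s B where sB: "q = prod_encode (jterm_code s, fm_code B)" "E w s B" "q \<in> set_decode V"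
      using q by (auto simp: ev_def)
    have "psnd t = prod_encode (jterm_code r, jterm_code s)"
      using * by (simp add: pair_eqI rA(1) sB(1))
    then have t': "t = jterm_code (App r s)" using * by (simp add: pair_eqI)
    obtain C where C: "A = Imp B C"
      using * by (cases A) (auto simp: rA(1) sB(1) inj_fm_code)
    have "prod_encode (t, snd_arg (psnd p)) \<in> set_decode V"
      using VT rA(3) sB(3) t * unfolding ev_closed_def by blast
    then show "prod_encode (t, snd_arg (psnd p)) \<in> ev w"
      using ev[of "App r s" C] E_app[of w r B C s] rA(2) sB(2) by (simp add: t' rA(1) C)
  qed
  have holds_iff: "holds (lform_code y) (wc (lab1 (lform_code y))) (wc (lab2 (lform_code y)))
      \<longleftrightarrow> sat (\<lambda>w. w) y" if y: "y \<in> set xs \<union> set ys" for y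
  proof (cases y)
    case (Forces w A)
    then show ?thesis using ok(1)[OF y] by (auto simp: holds_def wc fo entry_ok_def)
  next
    case (Rel w v)
    then show ?thesis
      using ok(2)[OF y] R_acc[of w v] acc_R[of w v] by (auto simp: holds_def entry_in_def)
  next
    case (Ev w t A)
    then show ?thesis using ok(2)[OF y] by (auto simp: holds_def wc ev entry_in_def)
  qed
  have named: "psnd m = wc l" if "m \<in> N" "pfst m = Suc l" for m l
    using that by (auto simp: N_def)
  have "countermodel K x T S L M"
    unfolding countermodel_def
  proof (intro conjI)
    have "N \<noteq> {}" by (auto simp: N_def)
    then show "M \<noteq> 0" using decM by auto
    show "\<forall>l\<in>set_decode L. \<exists>m\<in>set_decode M. pfst m = Suc l"
      unfolding decM N_def by force
    have "psnd m \<in> range wc" if "m \<in> N" for m using that psnd_N by blast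
    then show "\<forall>m\<in>set_decode M. locally_ok S M (psnd m) \<and> ev_closed K T (fst_arg (psnd m))"
      unfolding decM using local ev_closed by fastforce
    show "\<forall>y\<in>set (list_decode (pfst x)). \<forall>m\<in>set_decode M. \<forall>n\<in>set_decode M.
        pfst m = Suc (lab1 y) \<and> pfst n = Suc (lab2 y) \<longrightarrow> holds y (psnd m) (psnd n)"
      unfolding decM x list_decode_sequent_code set_map ball_simps
      using named holds_iff pos by (metis UnCI set_mset_mset)
    show "\<forall>y\<in>set (list_decode (psnd x)). \<forall>m\<in>set_decode M. \<forall>n\<in>set_decode M.
        pfst m = Suc (lab1 y) \<and> pfst n = Suc (lab2 y) \<longrightarrow> \<not> holds y (psnd m) (psnd n)"
      unfolding decM x list_decode_sequent_code set_map ball_simps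
      using named holds_iff neg by (metis UnCI set_mset_mset)
  qed
  moreover have "M < bound S V L"
    unfolding M_def bound_def by (rule set_encode_less[OF N_bound])
  ultimately show ?thesis by blast
qed


section \<open>The decision procedure\<close>

lemma prod_encode_leD: "prod_encode (a, b) \<le> n \<Longrightarrow> a \<le> n \<and> b \<le> n"
  using le_prod_encode_1[of a b] le_prod_encode_2[of b a] by linarith

lemma list_encode_ge: "a \<in> set l \<Longrightarrow> a \<le> list_encode l"
proof (induction l)
  case (Cons b l)
  then show ?case
    using le_prod_encode_1[of b "list_encode l"] le_prod_encode_2[of "list_encode l" b] by auto
qed simp

text \<open>A pair is at least as large as its components, so an initial segment is closed under
  subterms and subformulas. It replaces the exact set of subformulas and is finite by injectivity of
  the codes.\<close>

definition terms_upto :: "nat \<Rightarrow> jterm set" where "terms_upto n = {t. jterm_code t \<le> n}"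
definition fms_upto :: "nat \<Rightarrow> fm set" where "fms_upto n = {A. fm_code A \<le> n}"

lemma jterm_code_image_upto: "jterm_code ` terms_upto n \<subseteq> {..n}"
  by (auto simp: terms_upto_def)

lemma fm_code_image_upto: "fm_code ` fms_upto n \<subseteq> {..n}"
  by (auto simp: fms_upto_def)

lemma finite_terms_upto [simp]: "finite (terms_upto n)"
  by (rule finite_imageD[OF finite_subset[OF jterm_code_image_upto]])
     (auto simp: inj_on_def inj_jterm_code)

lemma finite_fms_upto [simp]: "finite (fms_upto n)"
  by (rule finite_imageD[OF finite_subset[OF fm_code_image_upto]])
     (auto simp: inj_on_def inj_fm_code)

lemma terms_uptoD:
  "App s t \<in> terms_upto n \<Longrightarrow> s \<in> terms_upto n \<and> t \<in> terms_upto n"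
  "Plus s t \<in> terms_upto n \<Longrightarrow> s \<in> terms_upto n \<and> t \<in> terms_upto n"
  "Bang t \<in> terms_upto n \<Longrightarrow> t \<in> terms_upto n"
  by (auto simp: terms_upto_def dest!: prod_encode_leD)

lemma fms_uptoD:
  "Neg A \<in> fms_upto n \<Longrightarrow> A \<in> fms_upto n"
  "And A B \<in> fms_upto n \<Longrightarrow> A \<in> fms_upto n \<and> B \<in> fms_upto n"
  "Or A B \<in> fms_upto n \<Longrightarrow> A \<in> fms_upto n \<and> B \<in> fms_upto n"
  "Imp A B \<in> fms_upto n \<Longrightarrow> A \<in> fms_upto n \<and> B \<in> fms_upto n"
  "Just t A \<in> fms_upto n \<Longrightarrow> t \<in> terms_upto n \<and> A \<in> fms_upto n"
  by (auto simp: fms_upto_def terms_upto_def dest!: prod_encode_leD)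

lemma tm_closed_upto: "tm_closed (set_encode (jterm_code ` terms_upto n))"
  unfolding tm_closed_def
proof
  fix t assume "t \<in> set_decode (set_encode (jterm_code ` terms_upto n))"
  then obtain s where s: "t = jterm_code s" "s \<in> terms_upto n" by auto
  show "pfst t = 0 \<or> pfst t = 1 \<or> (pfst t = 2 \<or> pfst t = 3) \<and>
      fst_arg t \<in> set_decode (set_encode (jterm_code ` terms_upto n)) \<and>
      snd_arg t \<in> set_decode (set_encode (jterm_code ` terms_upto n)) \<or>
     pfst t = 4 \<and> psnd t \<in> set_decode (set_encode (jterm_code ` terms_upto n))"
    using s(2) by (cases s) (auto simp: s(1) dest: terms_uptoD)
qed

lemma fm_closedI:
  assumes "finite S"
    and "\<And>A. Neg A \<in> S \<Longrightarrow> A \<in> S"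
    and "\<And>A B. And A B \<in> S \<Longrightarrow> A \<in> S \<and> B \<in> S"
    and "\<And>A B. Or A B \<in> S \<Longrightarrow> A \<in> S \<and> B \<in> S"
    and "\<And>A B. Imp A B \<in> S \<Longrightarrow> A \<in> S \<and> B \<in> S"
    and "\<And>t A. Just t A \<in> S \<Longrightarrow> jterm_code t \<in> set_decode T \<and> A \<in> S"
  shows "fm_closed T (set_encode (fm_code ` S))"
  unfolding fm_closed_def
proof
  let ?S = "set_encode (fm_code ` S)"
  fix a assume "a \<in> set_decode ?S"
  then obtain A where A: "a = fm_code A" "A \<in> S" using assms(1) by auto
  show "pfst a = 0 \<or> pfst a = 1 \<and> psnd a = 0 \<or>
     pfst a = 2 \<and> psnd a \<in> set_decode ?S \<or>
     (pfst a = 3 \<or> pfst a = 4 \<or> pfst a = 5) \<and> fst_arg a \<in> set_decode ?S \<and> snd_arg a \<in> set_decode ?S \<or>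
     pfst a = 6 \<and> fst_arg a \<in> set_decode T \<and> snd_arg a \<in> set_decode ?S"
    using A(2) by (cases A) (auto simp: A(1) assms(1) dest: assms(2-6))
qed

lemma sequent_entry_le:
  assumes "y \<in> set (list_decode (pfst x)) \<union> set (list_decode (psnd x))"
  shows "y \<le> x"
  using assms list_encode_ge[of y "list_decode (pfst x)"] list_encode_ge[of y "list_decode (psnd x)"]
    pfst_le[of x] psnd_le[of x] by auto

lemma lform_code_leD:
  "lform_code (Forces w A) \<le> n \<Longrightarrow> w \<le> n \<and> A \<in> fms_upto n"
  "lform_code (Rel w v) \<le> n \<Longrightarrow> w \<le> n \<and> v \<le> n"
  "lform_code (Ev w t A) \<le> n \<Longrightarrow> w \<le> n \<and> t \<in> terms_upto n \<and> A \<in> fms_upto n"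
  by (auto simp: fms_upto_def terms_upto_def dest!: prod_encode_leD)

text \<open>Only a lower bound for \<open>S\<close> is fixed: recognizing codes uses the segment
  itself, the universe extends it by evidenced formulas.\<close>

lemma wellformed_upto:
  assumes x: "x = sequent_code (xs, ys)" and "x \<le> n" "fms_upto n \<subseteq> S" "finite S"
    and S: "fm_closed (set_encode (jterm_code ` terms_upto n)) (set_encode (fm_code ` S))"
  shows "wellformed x (set_encode (jterm_code ` terms_upto n)) (set_encode (fm_code ` S))"
proof -
  have "entry_ok (set_encode (jterm_code ` terms_upto n)) (set_encode (fm_code ` S)) (lform_code z)"
    if "z \<in> set xs \<union> set ys" for z
  proof -
    have "lform_code z \<le> n"
      using sequent_entry_le[of "lform_code z" x] that \<open>x \<le> n\<close> by (auto simp: x)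
    then show ?thesis
      using assms(3,4) by (cases z) (auto simp: entry_ok_def simp del: lform_code.simps dest!: lform_code_leD, auto)
  qed
  then show ?thesis using S tm_closed_upto by (auto simp: wellformed_def x)
qed

abbreviation valid :: "nat \<Rightarrow> bool" where
  "valid x \<equiv> \<exists>T<2 ^ Suc x. \<exists>S<2 ^ Suc x. wellformed x T S"

text \<open>Subterms and subformulas of a coded sequent have codes at most \<open>x\<close>, so
  certifying sets can be chosen within \<open>{..x}\<close>; codes of such sets lie below
  \<open>2 ^ Suc x\<close>.\<close>

lemma valid_iff: "valid x \<longleftrightarrow> x \<in> range sequent_code"
proof
  assume "valid x"
  then show "x \<in> range sequent_code" using wellformed_code by blast
next
  assume "x \<in> range sequent_code"
  then obtain xs ys where x: "x = sequent_code (xs, ys)" by auto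
  have "wellformed x (set_encode (jterm_code ` terms_upto x)) (set_encode (fm_code ` fms_upto x))"
    by (rule wellformed_upto[OF x], simp, simp, simp, rule fm_closedI) (auto dest: fms_uptoD)
  moreover have "set_encode (jterm_code ` terms_upto x) < 2 ^ Suc x"
    "set_encode (fm_code ` fms_upto x) < 2 ^ Suc x"
    by (intro set_encode_less jterm_code_image_upto fm_code_image_upto)+
  ultimately show "valid x" by blast
qed

section \<open>Existence of a universe\<close>

text \<open>All formulas for which evidence \<open>t\<close> can arise when every formula with code at most \<open>n\<close> may
  have evidence. Application adds nothing, since implications never have the form \<open>t:A\<close>.\<close>

primrec evidenced :: "nat \<Rightarrow> jterm \<Rightarrow> fm set" where
  "evidenced n (JVar x) = fms_upto n"
| "evidenced n (JConst c) = fms_upto n"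
| "evidenced n (App s t) = fms_upto n"
| "evidenced n (Plus s t) = evidenced n s \<union> evidenced n t"
| "evidenced n (Bang t) = fms_upto n \<union> Just t ` evidenced n t"

lemma finite_evidenced [simp]: "finite (evidenced n t)"
  by (induction t) auto

lemma fms_upto_evidenced: "A \<in> fms_upto n \<Longrightarrow> A \<in> evidenced n t"
  by (induction t) auto

text \<open>Formulas outside the segment enter only through \<open>Bang\<close>. Hence only formulas
  \<open>s:B\<close> need a new closure argument; all other compound formulas lie in the
  segment.\<close>

lemma evidenced_cases:
  assumes "A \<in> evidenced n t" "t \<in> terms_upto n"
  shows "A \<in> fms_upto n \<or> (\<exists>s B. A = Just s B \<and> s \<in> terms_upto n \<and> B \<in> evidenced n s)"
  using assms by (induction t) (auto dest: terms_uptoD)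

lemma universe_exists:
  assumes CS: "finite CS" "constant_specification CS" and K: "K = set_encode (fm_code ` CS)"
    and x: "x = sequent_code (xs, ys)"
  shows "\<exists>T S V L. universe K x T S V L"
proof -
  \<comment> \<open>Entries of the sequent have codes at most \<open>x\<close>, formulas of the
    specification have codes below \<open>K\<close>; the sum bounds both.\<close>
  define n where "n = x + K"
  define S where "S = fms_upto n \<union> (\<Union>t\<in>terms_upto n. evidenced n t)"
  define V where "V = (\<Union>t\<in>terms_upto n. (\<lambda>A. prod_encode (jterm_code t, fm_code A)) ` evidenced n t)"
  let ?T = "set_encode (jterm_code ` terms_upto n)"
  have fin: "finite S" "finite V" by (simp_all add: S_def V_def)
  have S_cases: "A \<in> fms_upto n \<or> (\<exists>s B. A = Just s B \<and> s \<in> terms_upto n \<and> B \<in> evidenced n s)"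
    if "A \<in> S" for A
    using that evidenced_cases by (auto simp: S_def)
  have S_Just: "t \<in> terms_upto n \<and> A \<in> evidenced n t" if "Just t A \<in> S" for t A
    using S_cases[OF that] fms_uptoD(5) fms_upto_evidenced by blast
  have decV: "prod_encode (jterm_code t, fm_code A) \<in> V \<longleftrightarrow> t \<in> terms_upto n \<and> A \<in> evidenced n t" for t A
    by (auto simp: V_def inj_jterm_code inj_fm_code)
  have "fm_closed ?T (set_encode (fm_code ` S))"
  proof (rule fm_closedI[OF fin(1)])
    show "jterm_code t \<in> set_decode ?T \<and> A \<in> S" if "Just t A \<in> S" for t A
      using S_Just[OF that] by (auto simp: S_def)
    show "A \<in> S" if "Neg A \<in> S" for A
      using S_cases[OF that] by (auto simp: S_def dest: fms_uptoD)
    show "A \<in> S \<and> B \<in> S" if "And A B \<in> S" for A B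
      using S_cases[OF that] by (auto simp: S_def dest: fms_uptoD)
    show "A \<in> S \<and> B \<in> S" if "Or A B \<in> S" for A B
      using S_cases[OF that] by (auto simp: S_def dest: fms_uptoD)
    show "A \<in> S \<and> B \<in> S" if "Imp A B \<in> S" for A B
      using S_cases[OF that] by (auto simp: S_def dest: fms_uptoD)
  qed
  then have wf: "wellformed x ?T (set_encode (fm_code ` S))"
    by (intro wellformed_upto[OF x]) (auto simp: n_def S_def)
  have "ev_closed K ?T (set_encode V)"
    unfolding ev_closed_def
  proof (intro conjI ballI impI)
    fix a assume a: "a \<in> set_decode K"
    then obtain F where F: "F \<in> CS" "a = fm_code F" using CS(1) K by auto
    then obtain c A where cA: "F = Just (JConst c) A"
      using CS(2) unfolding constant_specification_def by blast
    have "F \<in> fms_upto n" using set_decode_less[OF a] by (simp add: fms_upto_def n_def F)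
    then have "JConst c \<in> terms_upto n" "A \<in> fms_upto n" using fms_uptoD(5) cA by blast+
    then show "psnd a \<in> set_decode (set_encode V)"
      using decV[of "JConst c" A] fin by (simp add: F cA)
  next
    fix p t assume p: "p \<in> set_decode (set_encode V)" and t: "t \<in> set_decode ?T"
      and *: "pfst t = 3 \<and> (fst_arg t = pfst p \<or> snd_arg t = pfst p)"
    obtain r A where rA: "p = prod_encode (jterm_code r, fm_code A)" "r \<in> terms_upto n" "A \<in> evidenced n r"
      using p fin by (auto simp: V_def)
    obtain t' where t': "t = jterm_code t'" "t' \<in> terms_upto n" using t by auto
    have "A \<in> evidenced n t'" using * rA(3) by (cases t') (auto simp: t' rA(1) inj_jterm_code)
    then show "prod_encode (t, psnd p) \<in> set_decode (set_encode V)"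
      using decV[of t' A] t' fin by (simp add: rA(1))
  next
    fix p t assume p: "p \<in> set_decode (set_encode V)" and t: "t \<in> set_decode ?T"
      and *: "pfst t = 4 \<and> psnd t = pfst p"
    obtain r A where rA: "p = prod_encode (jterm_code r, fm_code A)" "r \<in> terms_upto n" "A \<in> evidenced n r"
      using p fin by (auto simp: V_def)
    have t': "t = jterm_code (Bang r)" using * by (simp add: pair_eqI rA(1))
    then have "Bang r \<in> terms_upto n"
      using t by (auto simp: inj_jterm_code simp del: jterm_code.simps)
    then show "prod_encode (t, prod_encode (6, p)) \<in> set_decode (set_encode V)"
      using decV[of "Bang r" "Just r A"] rA(3) fin by (simp add: t' rA(1))
  next
    fix p t q assume p: "p \<in> set_decode (set_encode V)" and t: "t \<in> set_decode ?T"
      and q: "q \<in> set_decode (set_encode V)"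
      and *: "pfst t = 2 \<and> fst_arg t = pfst p \<and> snd_arg t = pfst q \<and>
          fst_arg p = 5 \<and> fst_arg (psnd p) = psnd q"
    obtain r A where rA: "p = prod_encode (jterm_code r, fm_code A)" "r \<in> terms_upto n" "A \<in> evidenced n r"
      using p fin by (auto simp: V_def)
    obtain s B where sB: "q = prod_encode (jterm_code s, fm_code B)"
      using q fin by (auto simp: V_def)
    have "psnd t = prod_encode (jterm_code r, jterm_code s)"
      using * by (simp add: pair_eqI rA(1) sB(1))
    then have t': "t = jterm_code (App r s)" using * by (simp add: pair_eqI)
    then have "App r s \<in> terms_upto n"
      using t by (auto simp: inj_jterm_code simp del: jterm_code.simps)
    moreover obtain C where C: "A = Imp B C"
      using * by (cases A) (auto simp: rA(1) sB(1) inj_fm_code)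
    \<comment> \<open>An implication is not of the form \<open>s:B\<close>, so \<open>A\<close> lies
      in the segment, and \<open>C\<close> with it.\<close>
    moreover have "C \<in> fms_upto n"
      using evidenced_cases[OF rA(3,2)] by (auto simp: C dest: fms_uptoD(4))
    ultimately show "prod_encode (t, snd_arg (psnd p)) \<in> set_decode (set_encode V)"
      using decV[of "App r s" C] fin by (simp add: t' rA(1))
  qed
  moreover have "\<forall>p\<in>set_decode (set_encode V).
      pfst p \<in> set_decode ?T \<and> psnd p \<in> set_decode (set_encode (fm_code ` S))"
    using fin by (auto simp: V_def S_def)
  moreover have "\<forall>a\<in>set_decode (set_encode (fm_code ` S)). pfst a = 6 \<longrightarrow> psnd a \<in> set_decode (set_encode V)"
  proof (intro ballI impI)
    fix a assume "a \<in> set_decode (set_encode (fm_code ` S))" "pfst a = 6"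
    then obtain B where B: "a = fm_code B" "B \<in> S" "pfst (fm_code B) = 6"
      using fin by auto
    then obtain t A where "a = fm_code (Just t A)" "Just t A \<in> S" by (cases B) auto
    then show "psnd a \<in> set_decode (set_encode V)" using S_Just[of t A] decV[of t A] fin by simp
  qed
  moreover have "entry_in (set_encode V) (set_encode {..n}) (lform_code z)" if "z \<in> set xs \<union> set ys" for z
  proof -
    have "lform_code z \<le> n"
      using sequent_entry_le[of "lform_code z" x] that by (auto simp: x n_def)
    then show ?thesis
    proof (cases z)
      case (Forces w A)
      then show ?thesis using lform_code_leD(1)[of w A n] \<open>lform_code z \<le> n\<close>
        by (simp add: entry_in_def)
    next
      case (Rel w v)
      then show ?thesis using lform_code_leD(2)[of w v n] \<open>lform_code z \<le> n\<close>
        by (simp add: entry_in_def)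
    next
      case (Ev w t A)
      then have "w \<le> n" "t \<in> terms_upto n" "A \<in> fms_upto n"
        using lform_code_leD(3)[of w t A n] \<open>lform_code z \<le> n\<close> by blast+
      then show ?thesis using Ev decV[of t A] fin fms_upto_evidenced by (simp add: entry_in_def)
    qed
  qed
  ultimately have "universe K x ?T (set_encode (fm_code ` S)) (set_encode V) (set_encode {..n})"
    using wf unfolding universe_def x list_decode_sequent_code by auto
  then show ?thesis by blast
qed

theorem theorem9p3:
  fixes CS :: "fm set"
  assumes "constant_specification CS"
    and "finite CS"
  shows "decidable_via sequent_code (\<lambda>(xs, ys). G3LP CS (mset xs) (mset ys))"
proof -
  define K where "K = set_encode (fm_code ` CS)"
  define univ_of where "univ_of = (\<lambda>u x. universe K x (pfst u) (fst_arg u) (pfst (snd_arg u)) (psnd (snd_arg u)))"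
  define cm where "cm = (\<lambda>M e. countermodel K (psnd e) (pfst (pfst e)) (fst_arg (pfst e)) (psnd (snd_arg (pfst e))) M)"
  define bd where "bd = (\<lambda>e. bound (fst_arg (pfst e)) (pfst (snd_arg (pfst e))) (psnd (snd_arg (pfst e))))"
  \<comment> \<open>The second disjunct assigns 0 to numbers that are no sequent codes, so that
    minimization is regular. Whichever universe is found serves, since both directions of
    correctness hold for every universe.\<close>
  define U where "U x = (LEAST u. univ_of u x \<or> \<not> valid x)" for x
  have univ_ex: "\<exists>u. univ_of u x \<or> \<not> valid x" for x
  proof (cases "valid x")
    case True
    then obtain xs ys where "x = sequent_code (xs, ys)" unfolding valid_iff by auto
    from universe_exists[OF assms(2,1) K_def this]
    obtain T S V L where "universe K x T S V L" by blast
    then have "univ_of (prod_encode (T, prod_encode (S, prod_encode (V, L)))) x"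
      by (simp add: univ_of_def)
    then show ?thesis by blast
  qed blast
  have "computable U"
    unfolding U_def
    by (rule computable_Least[OF _ univ_ex], unfold univ_of_def)
       (intro dec_disj dec_universe dec_not dec_comp[OF dec_valid] computable_psnd computable_id)
  then have pairU: "computable (\<lambda>x. prod_encode (U x, x))"
    by (intro computable_pair computable_id)
  have "dec (\<lambda>e. \<exists>M<bd e. cm M e)"
    unfolding bd_def bound_def
    by (rule dec_ex_less, unfold cm_def, rule dec_countermodel) (intro computable_intros)
  from dec_not[OF dec_comp[OF this pairU]]
  have "computable (\<lambda>x. if \<not> (\<exists>M<bd (prod_encode (U x, x)). cm M (prod_encode (U x, x))) then 1 else 0)"
    unfolding dec_def .
  then obtain f where f: "recursive 1 f"
    "\<And>x. f [x] = (if \<not> (\<exists>M<bd (prod_encode (U x, x)). cm M (prod_encode (U x, x))) then 1 else 0)"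
    unfolding computable_def by blast
  have "(\<not> (\<exists>M<bd (prod_encode (U x, x)). cm M (prod_encode (U x, x)))) \<longleftrightarrow> G3LP CS (mset xs) (mset ys)"
    if x: "x = sequent_code (xs, ys)" for x xs ys
  proof -
    have "univ_of (U x) x \<or> \<not> valid x" unfolding U_def by (rule LeastI_ex[OF univ_ex])
    then have "univ_of (U x) x" using valid_iff x by blast
    then show ?thesis
      using countermodel_underivable[OF assms(2) K_def x] underivable_countermodel[OF assms(2,1) K_def x]
      unfolding univ_of_def cm_def bd_def pfst_pair psnd_pair by blast
  qed
  with f show ?thesis
    unfolding decidable_via_def by (intro exI[of _ f]) (auto simp: split_beta)
qed

end
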